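(* Let $n\ge 2$. For $2\le k\le n$ let $\varphi_{n,k}:NF^n\times NF^n\to NF^n$ be the bilinear map with $\varphi_{n,k}(x_n,x_1)=x_k$ and value zero on all other pairs of basis elements. Then the cohomology classes $\overline{\varphi_{n,k}}$, $2\le k\le n$, form a basis of $HL^2(NF^n,NF^n)$. Consequently, $\dim HL^2(NF^n,NF^n)=n-1$.
   Context: $F$ is a field of characteristic zero. $NF^n$ (the null-filiform Leibniz algebra) is the $n$-dimensional $F$-algebra with basis $x_1,\dots,x_n$ and products $[x_i,x_1]=x_{i+1}$ for $1\le i\le n-1$, all other products of basis elements being zero. For a (right) Leibniz algebra $L$, i.e. an algebra with $[x,[y,z]]=[[x,y],z]-[[x,z],y]$, the space $ZL^2(L,L)$ of 2-cocycles consists of the bilinear maps $\varphi:L\times L\to L$ such that for all $x,y,z\in L$ $$[x,\varphi(y,z)]-[\varphi(x,y),z]+[\varphi(x,z),y]+\varphi(x,[y,z])-\varphi([x,y],z)+\varphi([x,z],y)=0.$$ The space $BL^2(L,L)$ of 2-coboundaries consists of the maps $d^1f$, $f:L\to L$ linear, where $(d^1f)(x,y)=[x,f(y)]+[f(x),y]-f([x,y])$. $HL^2(L,L)=ZL^2(L,L)/BL^2(L,L)$. *)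

theory Defs
  imports "HOL-Algebra.QuotRing" "Jordan_Normal_Form.Missing_VectorSpace"
begin

definition char_zero :: "('k, 'm) ring_scheme \<Rightarrow> bool" where
  "char_zero K \<longleftrightarrow> (\<forall>m::nat. m > 0 \<longrightarrow> [m] \<cdot>\<^bsub>K\<^esub> \<one>\<^bsub>K\<^esub> \<noteq> \<zero>\<^bsub>K\<^esub>)"


section \<open>Quotient modules\<close>

text \<open>
  The scalar multiple of a coset is formed through representatives, as
  \<^const>\<open>rcoset_mult\<close> does for products. The elementwise image would be wrong for the
  scalar zero. The fields \<^const>\<open>mult\<close> and \<^const>\<open>one\<close> of a module record play no role.
\<close>
definition quot_module ::
  "('k, 'v, 'm) module_scheme \<Rightarrow> 'v set \<Rightarrow> ('k, 'v set) module" where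
  "quot_module M N =
    \<lparr>carrier = a_rcosets\<^bsub>M\<^esub> N,
     mult = undefined, one = undefined,
     zero = N,
     add = set_add M,
     smult = (\<lambda>c X. \<Union>v\<in>X. N +>\<^bsub>M\<^esub> (c \<odot>\<^bsub>M\<^esub> v))\<rparr>"


section \<open>Second cohomology of an algebra with coefficients in itself\<close>

definition bilinear_map ::
  "('k, 'r) ring_scheme \<Rightarrow> ('k, 'v, 'm) module_scheme \<Rightarrow> ('v \<Rightarrow> 'v \<Rightarrow> 'v) \<Rightarrow> bool" where
  "bilinear_map K L f \<longleftrightarrow>
     (\<forall>v\<in>carrier L. f v \<in> module_hom K L L) \<and>
     (\<forall>w\<in>carrier L. (\<lambda>v. f v w) \<in> module_hom K L L)"

text \<open>
  Cochains are extensional functions on pairs, so that a bilinear map on the carrier is represented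
  by exactly one HOL function.
\<close>
definition C2 ::
  "('k, 'r) ring_scheme \<Rightarrow> ('k, 'v, 'm) module_scheme \<Rightarrow> ('v \<times> 'v \<Rightarrow> 'v) set" where
  "C2 K L = {\<phi> \<in> carrier L \<times> carrier L \<rightarrow>\<^sub>E carrier L. bilinear_map K L (curry \<phi>)}"

definition C2_module ::
  "('k, 'r) ring_scheme \<Rightarrow> ('k, 'v, 'm) module_scheme \<Rightarrow> ('k, 'v \<times> 'v \<Rightarrow> 'v) module" where
  "C2_module K L =
    \<lparr>carrier = C2 K L,
     mult = undefined, one = undefined,
     zero = (\<lambda>p\<in>carrier L \<times> carrier L. \<zero>\<^bsub>L\<^esub>),
     add = (\<lambda>\<phi> \<psi>. \<lambda>p\<in>carrier L \<times> carrier L. \<phi> p \<oplus>\<^bsub>L\<^esub> \<psi> p),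
     smult = (\<lambda>c \<phi>. \<lambda>p\<in>carrier L \<times> carrier L. c \<odot>\<^bsub>L\<^esub> \<phi> p)\<rparr>"

definition ZL2 ::
  "('k, 'r) ring_scheme \<Rightarrow> ('k, 'v, 'm) module_scheme \<Rightarrow> ('v \<Rightarrow> 'v \<Rightarrow> 'v) \<Rightarrow> ('v \<times> 'v \<Rightarrow> 'v) set"
  where
  "ZL2 K L br = {\<phi> \<in> C2 K L.
     \<forall>x\<in>carrier L. \<forall>y\<in>carrier L. \<forall>z\<in>carrier L.
       br x (\<phi> (y, z)) \<ominus>\<^bsub>L\<^esub> br (\<phi> (x, y)) z \<oplus>\<^bsub>L\<^esub> br (\<phi> (x, z)) y
         \<oplus>\<^bsub>L\<^esub> \<phi> (x, br y z) \<ominus>\<^bsub>L\<^esub> \<phi> (br x y, z) \<oplus>\<^bsub>L\<^esub> \<phi> (br x z, y) = \<zero>\<^bsub>L\<^esub>}"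

definition d1 ::
  "('k, 'v, 'm) module_scheme \<Rightarrow> ('v \<Rightarrow> 'v \<Rightarrow> 'v) \<Rightarrow> ('v \<Rightarrow> 'v) \<Rightarrow> ('v \<times> 'v \<Rightarrow> 'v)" where
  "d1 L br f =
     (\<lambda>(x, y)\<in>carrier L \<times> carrier L. br x (f y) \<oplus>\<^bsub>L\<^esub> br (f x) y \<ominus>\<^bsub>L\<^esub> f (br x y))"

definition BL2 ::
  "('k, 'r) ring_scheme \<Rightarrow> ('k, 'v, 'm) module_scheme \<Rightarrow> ('v \<Rightarrow> 'v \<Rightarrow> 'v) \<Rightarrow> ('v \<times> 'v \<Rightarrow> 'v) set"
  where
  "BL2 K L br = d1 L br ` module_hom K L L"

definition ZL2_module ::
  "('k, 'r) ring_scheme \<Rightarrow> ('k, 'v, 'm) module_scheme \<Rightarrow> ('v \<Rightarrow> 'v \<Rightarrow> 'v)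
    \<Rightarrow> ('k, 'v \<times> 'v \<Rightarrow> 'v) module" where
  "ZL2_module K L br = (C2_module K L)\<lparr>carrier := ZL2 K L br\<rparr>"

definition HL2 ::
  "('k, 'r) ring_scheme \<Rightarrow> ('k, 'v, 'm) module_scheme \<Rightarrow> ('v \<Rightarrow> 'v \<Rightarrow> 'v)
    \<Rightarrow> ('k, ('v \<times> 'v \<Rightarrow> 'v) set) module" where
  "HL2 K L br = quot_module (ZL2_module K L br) (BL2 K L br)"

definition coh_class ::
  "('k, 'r) ring_scheme \<Rightarrow> ('k, 'v, 'm) module_scheme \<Rightarrow> ('v \<Rightarrow> 'v \<Rightarrow> 'v)
    \<Rightarrow> ('v \<times> 'v \<Rightarrow> 'v) \<Rightarrow> ('v \<times> 'v \<Rightarrow> 'v) set" where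
  "coh_class K L br \<phi> = BL2 K L br +>\<^bsub>ZL2_module K L br\<^esub> \<phi>"


section \<open>The null-filiform Leibniz algebra\<close>

text \<open>
  The algebra is given by its vector space, its bracket and the basis in which the products take
  the prescribed form. These data determine it up to isomorphism.
\<close>
locale null_filiform = vectorspace K L
  for K :: "('k, 'r) ring_scheme" and L :: "('k, 'v, 'm) module_scheme" +
  fixes br :: "'v \<Rightarrow> 'v \<Rightarrow> 'v" and n :: nat and x :: "nat \<Rightarrow> 'v"
  assumes bracket_bilinear: "bilinear_map K L br"
    and basis_inj: "inj_on x {1..n}"
    and basis_x: "basis (x ` {1..n})"
    and bracket_x: "\<lbrakk>i \<in> {1..n}; j \<in> {1..n}\<rbrakk> \<Longrightarrow>
      br (x i) (x j) = (if j = 1 \<and> i < n then x (i + 1) else \<zero>\<^bsub>L\<^esub>)"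

definition nf_cocycle ::
  "('k, 'r) ring_scheme \<Rightarrow> ('k, 'v, 'm) module_scheme \<Rightarrow> nat \<Rightarrow> (nat \<Rightarrow> 'v) \<Rightarrow> nat
    \<Rightarrow> ('v \<times> 'v \<Rightarrow> 'v)" where
  "nf_cocycle K L n x k = (THE \<phi>. \<phi> \<in> C2 K L \<and>
     (\<forall>i\<in>{1..n}. \<forall>j\<in>{1..n}. \<phi> (x i, x j) = (if i = n \<and> j = 1 then x k else \<zero>\<^bsub>L\<^esub>)))"

end

theory Submission
  imports Defs
begin

text \<open>
  Write \<open>e\<close> for the \<open>x\<^sub>1\<close>-coordinate and \<open>S\<close> for the shift \<open>v \<mapsto> [v, x\<^sub>1]\<close>, so that \<open>[v, w] = e(w) S(v)\<close>.
  The cocycle identity at \<open>(u, v, x\<^sub>1)\<close> and \<open>(u, x\<^sub>1, v)\<close> with \<open>e(v) = 0\<close>, and at \<open>(u, x\<^sub>1, x\<^sub>1)\<close>, forces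
  \<open>\<phi>(u, x\<^bsub>i+1\<^esub>) = - e(\<phi>(x\<^sub>i, x\<^sub>1)) S(u)\<close> for \<open>i \<le> n\<close>, where \<open>x\<^bsub>n+1\<^esub> = 0\<close>. Hence the linear map with
  \<open>f(x\<^sub>1) = 0\<close> and \<open>f(x\<^bsub>i+1\<^esub>) = S(f(x\<^sub>i)) - \<phi>(x\<^sub>i, x\<^sub>1)\<close> makes \<open>\<phi> - d\<^sup>1f\<close> vanish on all pairs of basis
  elements except \<open>(x\<^sub>n, x\<^sub>1)\<close>, where its value has no \<open>x\<^sub>1\<close>-component. Conversely, if
  \<open>\<Sum> c\<^sub>k \<phi>\<^sub>k = d\<^sup>1f\<close> then \<open>f(x\<^bsub>i+1\<^esub>) = a x\<^bsub>i+1\<^esub> + S(f(x\<^sub>i))\<close>, so \<open>f(x\<^sub>n)\<close> is a multiple of \<open>x\<^sub>n\<close> and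
  \<open>\<Sum> c\<^sub>k x\<^sub>k = S(f(x\<^sub>n)) = 0\<close>.
\<close>

section \<open>Families forming a basis\<close>

lemma (in abelian_group) a_inv_zero: "\<ominus> \<zero> = \<zero>"
  by (simp add: a_inv_def)

text \<open>The library declares these rules for the \<open>algebra\<close> proof method in rings only.\<close>

lemmas (in abelian_group) abelian_group_simprules
  [algebra ring "zero G" "add G" "a_inv G" "a_minus G"] =
  a_closed zero_closed a_inv_closed minus_closed
  a_assoc l_zero l_neg a_comm minus_eq
  r_zero r_neg r_neg2 r_neg1 minus_add minus_minus a_inv_zero a_lcomm

lemma (in module) finsum_delta:
  assumes "finite I" "i \<in> I" "v \<in> I \<rightarrow> carrier M"
  shows "(\<Oplus>\<^bsub>M\<^esub>j\<in>I. (if j = i then \<one> else \<zero>) \<odot>\<^bsub>M\<^esub> v j) = v i"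
proof -
  have "(\<Oplus>\<^bsub>M\<^esub>j\<in>I. (if j = i then \<one> else \<zero>) \<odot>\<^bsub>M\<^esub> v j) = (\<Oplus>\<^bsub>M\<^esub>j\<in>I. if i = j then v j else \<zero>\<^bsub>M\<^esub>)"
    using assms by (intro M.finsum_cong') (auto simp: Pi_iff)
  also have "\<dots> = v i"
    using assms by (intro M.add.finprod_singleton) auto
  finally show ?thesis .
qed

text \<open>Unique existence is transported along a bijection. It serves to pass from coefficient
  functions on a set of vectors to coefficient functions on an index set.\<close>

lemma bij_betw_Ex1:
  assumes "bij_betw g A B"
  shows "(\<exists>!a. a \<in> A \<and> P (g a)) \<longleftrightarrow> (\<exists>!b. b \<in> B \<and> P b)"
proof -
  have "(\<exists>!b. b \<in> B \<and> P b) \<longleftrightarrow> (\<exists>b\<in>B. P b \<and> (\<forall>b'\<in>B. P b' \<longrightarrow> b' = b))"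
    by blast
  also have "\<dots> \<longleftrightarrow> (\<exists>a\<in>A. P (g a) \<and> (\<forall>a'\<in>A. P (g a') \<longrightarrow> g a' = g a))"
    using bij_betw_imp_surj_on[OF assms] by blast
  also have "\<dots> \<longleftrightarrow> (\<exists>a\<in>A. P (g a) \<and> (\<forall>a'\<in>A. P (g a') \<longrightarrow> a' = a))"
    using bij_betw_imp_inj_on[OF assms] by (simp add: inj_on_eq_iff cong: conj_cong)
  also have "\<dots> \<longleftrightarrow> (\<exists>!a. a \<in> A \<and> P (g a))"
    by blast
  finally show ?thesis ..
qed

text \<open>The criterion \<open>basis_criterion\<close> concerns coefficient functions on a set of
  vectors. For an injective family these correspond bijectively to coefficient functions on the
  index set. Conversely, uniqueness of coefficients on the index set already forces injectivity, so
  one condition encodes both properties.\<close>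

lemma (in vectorspace) basis_family_iff:
  assumes fin: "finite I" and x: "x \<in> I \<rightarrow> carrier V"
  shows "inj_on x I \<and> basis (x ` I) \<longleftrightarrow>
    (\<forall>v\<in>carrier V. \<exists>!a. a \<in> I \<rightarrow>\<^sub>E carrier K \<and> (\<Oplus>\<^bsub>V\<^esub>i\<in>I. a i \<odot>\<^bsub>V\<^esub> x i) = v)"
proof -
  let ?comb = "\<lambda>a. \<Oplus>\<^bsub>V\<^esub>i\<in>I. a i \<odot>\<^bsub>V\<^esub> x i"
  have main: "basis (x ` I) \<longleftrightarrow> (\<forall>v\<in>carrier V. \<exists>!a. a \<in> I \<rightarrow>\<^sub>E carrier K \<and> ?comb a = v)"
    if inj: "inj_on x I"
  proof -
    \<comment> \<open>Injectivity is essential for this reindexing: otherwise a repeated vector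
      would be counted once on the left and several times on the right.\<close>
    have lc: "lincomb b (x ` I) = ?comb (\<lambda>i\<in>I. b (x i))" if "b \<in> x ` I \<rightarrow> carrier K" for b
    proof -
      have "lincomb b (x ` I) = (\<Oplus>\<^bsub>V\<^esub>i\<in>I. b (x i) \<odot>\<^bsub>V\<^esub> x i)"
        unfolding lincomb_def using x that inj by (intro finsum_reindex) (auto simp: Pi_iff)
      also have "\<dots> = ?comb (\<lambda>i\<in>I. b (x i))"
        using x that by (intro finsum_cong') (auto simp: Pi_iff)
      finally show ?thesis .
    qed
    let ?g = "\<lambda>b. \<lambda>i\<in>I. b (x i)"
    have bij: "bij_betw ?g (x ` I \<rightarrow>\<^sub>E carrier K) (I \<rightarrow>\<^sub>E carrier K)"
    proof (rule bij_betwI[where g = "\<lambda>a. \<lambda>w\<in>x ` I. a (the_inv_into I x w)"])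
      show "?g \<in> (x ` I \<rightarrow>\<^sub>E carrier K) \<rightarrow> (I \<rightarrow>\<^sub>E carrier K)" by auto
      show "(\<lambda>a. \<lambda>w\<in>x ` I. a (the_inv_into I x w)) \<in> (I \<rightarrow>\<^sub>E carrier K) \<rightarrow> (x ` I \<rightarrow>\<^sub>E carrier K)"
        using inj by (auto simp: the_inv_into_f_f)
      show "(\<lambda>w\<in>x ` I. ?g b (the_inv_into I x w)) = b" if "b \<in> x ` I \<rightarrow>\<^sub>E carrier K" for b
        using that inj by (auto simp: fun_eq_iff the_inv_into_f_f PiE_iff extensional_def)
      show "?g (\<lambda>w\<in>x ` I. a (the_inv_into I x w)) = a" if "a \<in> I \<rightarrow>\<^sub>E carrier K" for a
        using that inj by (auto simp: fun_eq_iff the_inv_into_f_f PiE_iff extensional_def)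
    qed
    have "(\<exists>!b. b \<in> x ` I \<rightarrow>\<^sub>E carrier K \<and> lincomb b (x ` I) = v) \<longleftrightarrow>
        (\<exists>!a. a \<in> I \<rightarrow>\<^sub>E carrier K \<and> ?comb a = v)" (is "?L = ?R") for v
    proof -
      have "lincomb b (x ` I) = ?comb (?g b)" if "b \<in> x ` I \<rightarrow>\<^sub>E carrier K" for b
        using that by (intro lc) (auto simp: PiE_iff)
      then have "?L \<longleftrightarrow> (\<exists>!b. b \<in> x ` I \<rightarrow>\<^sub>E carrier K \<and> ?comb (?g b) = v)"
        by (intro arg_cong[where f = Ex1] ext conj_cong) auto
      also have "\<dots> \<longleftrightarrow> ?R"
        by (rule bij_betw_Ex1[OF bij, where P = "\<lambda>a. ?comb a = v"])
      finally show ?thesis .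
    qed
    then show ?thesis
      using basis_criterion[of "x ` I"] fin x by (simp add: image_subset_iff Pi_iff Ball_def)
  qed
  \<comment> \<open>If \<open>x i = x j\<close>, the two unit coefficient families at
    \<open>i\<close> and \<open>j\<close> represent the same vector, so they agree. Evaluation at
    \<open>i\<close> then gives \<open>i = j\<close>, because one and zero differ in a
    field.\<close>
  have "inj_on x I" if u: "\<forall>v\<in>carrier V. \<exists>!a. a \<in> I \<rightarrow>\<^sub>E carrier K \<and> ?comb a = v"
  proof (rule inj_onI)
    fix i j assume ij: "i \<in> I" "j \<in> I" "x i = x j"
    let ?\<delta> = "\<lambda>i. \<lambda>j\<in>I. if j = i then \<one>\<^bsub>K\<^esub> else \<zero>\<^bsub>K\<^esub>"
    have \<delta>: "?\<delta> k \<in> I \<rightarrow>\<^sub>E carrier K \<and> ?comb (?\<delta> k) = x k" if "k \<in> I" for k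
    proof
      have "?comb (?\<delta> k) = (\<Oplus>\<^bsub>V\<^esub>j\<in>I. (if j = k then \<one>\<^bsub>K\<^esub> else \<zero>\<^bsub>K\<^esub>) \<odot>\<^bsub>V\<^esub> x j)"
        using x by (intro finsum_cong') (auto simp: Pi_iff)
      then show "?comb (?\<delta> k) = x k" using finsum_delta[OF fin that x] by simp
    qed auto
    have uniq: "\<exists>!a. a \<in> I \<rightarrow>\<^sub>E carrier K \<and> ?comb a = x i"
      using u x ij(1) by (simp add: Pi_iff)
    have "a = b" if "a \<in> I \<rightarrow>\<^sub>E carrier K \<and> ?comb a = x i" "b \<in> I \<rightarrow>\<^sub>E carrier K \<and> ?comb b = x i" for a b
      using uniq that by blast
    from this[OF \<delta>[OF ij(1)] \<delta>[OF ij(2), folded ij(3)]] have "?\<delta> i = ?\<delta> j" .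
    from fun_cong[OF this, of i] ij show "i = j" by (auto split: if_splits)
  qed
  with main show ?thesis by blast
qed

section \<open>Quotient modules\<close>

text \<open>Closure under negation comes from scalar multiplication by minus one. The result makes
  the library theory of additive cosets available for submodules.\<close>

lemma submodule_imp_abelian_subgroup:
  assumes "submodule R N M"
  shows "abelian_subgroup N M"
proof -
  interpret N: submodule R N M by (rule assms)
  interpret module R M by (rule N.module)
  have "\<ominus>\<^bsub>M\<^esub> v \<in> N" if "v \<in> N" for v
    using that N.subset N.smult_closed[of "\<ominus>\<^bsub>R\<^esub> \<one>\<^bsub>R\<^esub>" v] by (auto simp: smult_minus_1 subset_iff)
  then have "subgroup N (add_monoid M)"
    using N.subset by unfold_locales (auto simp: a_inv_def)
  then show ?thesis
    by (intro abelian_subgroupI3 additive_subgroupI M.abelian_group_axioms)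
qed

context
  fixes R :: "('k, 'r) ring_scheme" and M :: "('k, 'v, 'm) module_scheme" and N :: "'v set"
  assumes sub: "submodule R N M"
begin

interpretation N: submodule R N M by (rule sub)
interpretation module R M by (rule N.module)
interpretation N: abelian_subgroup N M by (rule submodule_imp_abelian_subgroup[OF sub])

lemma quot_module_carrier: "carrier (quot_module M N) = (\<lambda>v. N +>\<^bsub>M\<^esub> v) ` carrier M"
  unfolding quot_module_def A_RCOSETS_def' by auto

lemma quot_module_zero: "\<zero>\<^bsub>quot_module M N\<^esub> = N"
  by (simp add: quot_module_def)

lemma quot_module_add:
  "v \<in> carrier M \<Longrightarrow> w \<in> carrier M \<Longrightarrow>
    (N +>\<^bsub>M\<^esub> v) \<oplus>\<^bsub>quot_module M N\<^esub> (N +>\<^bsub>M\<^esub> w) = N +>\<^bsub>M\<^esub> (v \<oplus>\<^bsub>M\<^esub> w)"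
  by (simp add: quot_module_def N.a_rcos_sum)

lemma coset_eq_iff:
  assumes "v \<in> carrier M" "w \<in> carrier M"
  shows "N +>\<^bsub>M\<^esub> v = N +>\<^bsub>M\<^esub> w \<longleftrightarrow> v \<ominus>\<^bsub>M\<^esub> w \<in> N"
  using assms N.a_rcos_module[of w v]
    N.a_repr_independence'[of v w] N.a_rcos_self[of v] by (auto simp: a_minus_def)

lemma coset_eq_self_iff:
  assumes "v \<in> carrier M"
  shows "N +>\<^bsub>M\<^esub> v = N \<longleftrightarrow> v \<in> N"
  using coset_eq_iff[of v "\<zero>\<^bsub>M\<^esub>"] assms N.a_subset by (simp add: a_minus_def a_inv_def)

text \<open>The scalar multiple of a coset is defined as a union over all representatives. Any two
  representatives differ by an element of \<open>N\<close>, and \<open>N\<close> is closed under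
  scalars, so all members of the union are the same coset.\<close>

lemma quot_module_smult:
  assumes c: "c \<in> carrier R" and v: "v \<in> carrier M"
  shows "c \<odot>\<^bsub>quot_module M N\<^esub> (N +>\<^bsub>M\<^esub> v) = N +>\<^bsub>M\<^esub> (c \<odot>\<^bsub>M\<^esub> v)"
proof -
  have "N +>\<^bsub>M\<^esub> (c \<odot>\<^bsub>M\<^esub> w) = N +>\<^bsub>M\<^esub> (c \<odot>\<^bsub>M\<^esub> v)" if w: "w \<in> N +>\<^bsub>M\<^esub> v" for w
  proof -
    have wM: "w \<in> carrier M" using w v N.a_elemrcos_carrier by blast
    have "w \<ominus>\<^bsub>M\<^esub> v \<in> N"
      using N.a_rcos_module[OF v wM] w by (simp add: a_minus_def)
    then have "c \<odot>\<^bsub>M\<^esub> (w \<ominus>\<^bsub>M\<^esub> v) \<in> N" using c by simp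
    then show ?thesis
      using c v wM by (simp add: coset_eq_iff a_minus_def smult_r_distr smult_r_minus)
  qed
  moreover have "v \<in> N +>\<^bsub>M\<^esub> v" using v by (rule N.a_rcos_self)
  ultimately have "(\<Union>w\<in>N +>\<^bsub>M\<^esub> v. N +>\<^bsub>M\<^esub> (c \<odot>\<^bsub>M\<^esub> w)) = N +>\<^bsub>M\<^esub> (c \<odot>\<^bsub>M\<^esub> v)"
    by (intro SUP_eq_const) blast+
  then show ?thesis by (simp add: quot_module_def)
qed

lemma module_quot_module: "module R (quot_module M N)"
proof (rule module_criteria)
  show "cring R" ..
  have "N = N +>\<^bsub>M\<^esub> \<zero>\<^bsub>M\<^esub>" using coset_eq_self_iff[of "\<zero>\<^bsub>M\<^esub>"] by simp
  then show "\<zero>\<^bsub>quot_module M N\<^esub> \<in> carrier (quot_module M N)"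
    unfolding quot_module_zero quot_module_carrier by blast
  show "\<forall>v\<in>carrier (quot_module M N). \<exists>w\<in>carrier (quot_module M N).
      v \<oplus>\<^bsub>quot_module M N\<^esub> w = \<zero>\<^bsub>quot_module M N\<^esub>"
    unfolding quot_module_carrier
  proof safe
    fix v assume v: "v \<in> carrier M"
    then have "(N +>\<^bsub>M\<^esub> v) \<oplus>\<^bsub>quot_module M N\<^esub> (N +>\<^bsub>M\<^esub> (\<ominus>\<^bsub>M\<^esub> v)) = \<zero>\<^bsub>quot_module M N\<^esub>"
      by (simp add: quot_module_add quot_module_zero M.r_neg coset_eq_self_iff)
    then show "\<exists>w\<in>(+>\<^bsub>M\<^esub>) N ` carrier M.
        (N +>\<^bsub>M\<^esub> v) \<oplus>\<^bsub>quot_module M N\<^esub> w = \<zero>\<^bsub>quot_module M N\<^esub>"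
      using v by blast
  qed
  have zero: "(N +>\<^bsub>M\<^esub> v) \<oplus>\<^bsub>quot_module M N\<^esub> N = N +>\<^bsub>M\<^esub> v" if "v \<in> carrier M" for v
    using quot_module_add[OF that M.zero_closed] that coset_eq_self_iff[of "\<zero>\<^bsub>M\<^esub>"] by simp
  show "\<forall>v\<in>carrier (quot_module M N). v \<oplus>\<^bsub>quot_module M N\<^esub> \<zero>\<^bsub>quot_module M N\<^esub> = v"
    using zero by (auto simp: quot_module_carrier quot_module_zero)
qed (auto simp: quot_module_carrier quot_module_add quot_module_smult M.a_ac
      smult_l_distr smult_r_distr smult_assoc1)

text \<open>The projection onto the quotient is linear, so it commutes with finite linear
  combinations; this reduces questions about the quotient to membership in \<open>N\<close>.\<close>

lemma coset_finsum:
  assumes "finite I" "v \<in> I \<rightarrow> carrier M" "c \<in> I \<rightarrow> carrier R"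
  shows "(\<Oplus>\<^bsub>quot_module M N\<^esub>i\<in>I. c i \<odot>\<^bsub>quot_module M N\<^esub> (N +>\<^bsub>M\<^esub> v i))
    = N +>\<^bsub>M\<^esub> (\<Oplus>\<^bsub>M\<^esub>i\<in>I. c i \<odot>\<^bsub>M\<^esub> v i)"
proof -
  interpret Q: module R "quot_module M N" by (rule module_quot_module)
  show ?thesis using assms
  proof (induction I rule: finite_induct)
    case empty
    show ?case using coset_eq_self_iff[of "\<zero>\<^bsub>M\<^esub>"] by (simp add: quot_module_zero)
  next
    case (insert i I)
    then have v: "v \<in> I \<rightarrow> carrier M" "v i \<in> carrier M" and c: "c \<in> I \<rightarrow> carrier R" "c i \<in> carrier R"
      by auto
    then have "(\<lambda>i. c i \<odot>\<^bsub>M\<^esub> v i) \<in> I \<rightarrow> carrier M" by auto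
    moreover from v c
    have "(\<lambda>i. c i \<odot>\<^bsub>quot_module M N\<^esub> (N +>\<^bsub>M\<^esub> v i)) \<in> I \<rightarrow> carrier (quot_module M N)"
      by (auto simp: quot_module_carrier quot_module_smult Pi_iff)
    moreover have "N +>\<^bsub>M\<^esub> v i \<in> carrier (quot_module M N)"
      using v by (simp add: quot_module_carrier)
    ultimately show ?case
      using insert.IH[OF v(1) c(1)] insert.hyps v c
      by (subst Q.finsum_insert) (simp_all add: quot_module_add quot_module_smult quot_module_carrier M.finsum_closed)
  qed
qed

end

lemma vectorspace_quot_module:
  assumes "subspace K N V"
  shows "vectorspace K (quot_module V N)"
  using assms module_quot_module unfolding subspace_def vectorspace_def by blast

text \<open>Spanning modulo \<open>N\<close> gives existence of coefficients for each coset, and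
  independence modulo \<open>N\<close> gives their uniqueness. By \<open>basis_family_iff\<close>
  this yields the basis property together with injectivity of the family of cosets, which the
  dimension count relies on.\<close>

lemma basis_quot_module:
  assumes N: "subspace K N V" and fin: "finite I" and v: "v \<in> I \<rightarrow> carrier V"
    and ex: "\<And>w. w \<in> carrier V \<Longrightarrow>
      \<exists>c\<in>I \<rightarrow> carrier K. w \<ominus>\<^bsub>V\<^esub> (\<Oplus>\<^bsub>V\<^esub>i\<in>I. c i \<odot>\<^bsub>V\<^esub> v i) \<in> N"
    and indep: "\<And>c i. c \<in> I \<rightarrow> carrier K \<Longrightarrow> (\<Oplus>\<^bsub>V\<^esub>i\<in>I. c i \<odot>\<^bsub>V\<^esub> v i) \<in> N \<Longrightarrow> i \<in> I \<Longrightarrow>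
      c i = \<zero>\<^bsub>K\<^esub>"
  shows "inj_on (\<lambda>i. N +>\<^bsub>V\<^esub> v i) I
    \<and> vectorspace.basis K (quot_module V N) ((\<lambda>i. N +>\<^bsub>V\<^esub> v i) ` I)"
proof -
  interpret V: vectorspace K V using N unfolding subspace_def by blast
  have sub: "submodule K N V" using N unfolding subspace_def by blast
  interpret Q: vectorspace K "quot_module V N" by (rule vectorspace_quot_module[OF N])
  let ?comb = "\<lambda>c. \<Oplus>\<^bsub>V\<^esub>i\<in>I. c i \<odot>\<^bsub>V\<^esub> v i"
  let ?qcomb = "\<lambda>c. \<Oplus>\<^bsub>quot_module V N\<^esub>i\<in>I. c i \<odot>\<^bsub>quot_module V N\<^esub> (N +>\<^bsub>V\<^esub> v i)"
  have closed: "?comb c \<in> carrier V" if "c \<in> I \<rightarrow> carrier K" for c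
    using that v by (auto intro!: V.finsum_closed simp: Pi_iff)
  have "\<exists>!c. c \<in> I \<rightarrow>\<^sub>E carrier K \<and> ?qcomb c = X" if X: "X \<in> carrier (quot_module V N)" for X
  proof (rule ex_ex1I)
    obtain w where w: "w \<in> carrier V" "X = N +>\<^bsub>V\<^esub> w"
      using X by (auto simp: quot_module_carrier[OF sub])
    obtain c where c: "c \<in> I \<rightarrow> carrier K" "w \<ominus>\<^bsub>V\<^esub> ?comb c \<in> N"
      using ex[OF w(1)] by blast
    \<comment> \<open>Uniqueness can hold only among extensional coefficient functions, so the
      witness is cut down to \<open>I\<close>.\<close>
    have "?comb (restrict c I) = ?comb c"
      using c v by (intro V.finsum_cong') (auto simp: Pi_iff)
    moreover have "?qcomb (restrict c I) = N +>\<^bsub>V\<^esub> ?comb (restrict c I)"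
      using c v by (intro coset_finsum[OF sub fin]) auto
    moreover have "X = N +>\<^bsub>V\<^esub> ?comb c"
      using c w closed by (simp add: coset_eq_iff[OF sub])
    ultimately have "restrict c I \<in> I \<rightarrow>\<^sub>E carrier K \<and> ?qcomb (restrict c I) = X"
      using c by auto
    then show "\<exists>c. c \<in> I \<rightarrow>\<^sub>E carrier K \<and> ?qcomb c = X" by (rule exI[where x = "restrict c I"])
  next
    fix c d
    assume "c \<in> I \<rightarrow>\<^sub>E carrier K \<and> ?qcomb c = X" "d \<in> I \<rightarrow>\<^sub>E carrier K \<and> ?qcomb d = X"
    then have cE: "c \<in> I \<rightarrow>\<^sub>E carrier K" and dE: "d \<in> I \<rightarrow>\<^sub>E carrier K" and q: "?qcomb c = ?qcomb d"
      by auto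
    then have c: "c \<in> I \<rightarrow> carrier K" and d: "d \<in> I \<rightarrow> carrier K" by auto
    have "?comb c \<ominus>\<^bsub>V\<^esub> ?comb d \<in> N"
      using q coset_finsum[OF sub fin v c] coset_finsum[OF sub fin v d] closed[OF c] closed[OF d]
      by (simp add: coset_eq_iff[OF sub])
    moreover have "?comb c \<ominus>\<^bsub>V\<^esub> ?comb d = ?comb (\<lambda>i. c i \<ominus>\<^bsub>K\<^esub> d i)"
    proof -
      \<comment> \<open>The subtraction is proved in additive form, with \<open>?comb d\<close>
        moved to the other side, so that \<open>finsum_addf\<close> applies.\<close>
      have "?comb (\<lambda>i. c i \<ominus>\<^bsub>K\<^esub> d i) \<oplus>\<^bsub>V\<^esub> ?comb d
          = (\<Oplus>\<^bsub>V\<^esub>i\<in>I. (c i \<ominus>\<^bsub>K\<^esub> d i) \<odot>\<^bsub>V\<^esub> v i \<oplus>\<^bsub>V\<^esub> d i \<odot>\<^bsub>V\<^esub> v i)"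
        using c d v by (intro V.finsum_addf[symmetric]) (auto simp: Pi_iff)
      also have "\<dots> = ?comb c"
      proof (intro V.finsum_cong' refl)
        fix i assume "i \<in> I"
        then have mem: "c i \<in> carrier K" "d i \<in> carrier K" "v i \<in> carrier V" using c d v by auto
        then have "c i \<ominus>\<^bsub>K\<^esub> d i \<oplus>\<^bsub>K\<^esub> d i = c i" by algebra
        with mem show "(c i \<ominus>\<^bsub>K\<^esub> d i) \<odot>\<^bsub>V\<^esub> v i \<oplus>\<^bsub>V\<^esub> d i \<odot>\<^bsub>V\<^esub> v i = c i \<odot>\<^bsub>V\<^esub> v i"
          by (simp flip: V.smult_l_distr)
      qed (use c v in auto)
      finally have "?comb (\<lambda>i. c i \<ominus>\<^bsub>K\<^esub> d i) \<oplus>\<^bsub>V\<^esub> ?comb d = ?comb c" .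
      moreover have "?comb (\<lambda>i. c i \<ominus>\<^bsub>K\<^esub> d i) \<in> carrier V"
        using c d by (intro closed) auto
      ultimately show ?thesis
        using closed[OF d] by (metis V.M.add.inv_solve_right' V.minus_eq closed[OF c])
    qed
    ultimately have "c i \<ominus>\<^bsub>K\<^esub> d i = \<zero>\<^bsub>K\<^esub>" if "i \<in> I" for i
      using indep[of "\<lambda>i. c i \<ominus>\<^bsub>K\<^esub> d i" i] that c d by auto
    then have "c i = d i" if "i \<in> I" for i
      using that c d by (simp add: Pi_iff)
    with cE dE show "c = d" by (auto intro: PiE_ext)
  qed
  moreover have "(\<lambda>i. N +>\<^bsub>V\<^esub> v i) \<in> I \<rightarrow> carrier (quot_module V N)"
    using v by (auto simp: quot_module_carrier[OF sub])
  ultimately show ?thesis by (intro iffD2[OF Q.basis_family_iff[OF fin]] ballI)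
qed

section \<open>The modules of cochains, cocycles and coboundaries\<close>

text \<open>The ambient module of all extensional functions with pointwise operations. The cochain
  module is its restriction to the bilinear maps, so it inherits the module axioms as a
  submodule.\<close>

definition ext_fun_module :: "'i set \<Rightarrow> ('k, 'v, 'm) module_scheme \<Rightarrow> ('k, 'i \<Rightarrow> 'v) module" where
  "ext_fun_module A M =
    \<lparr>carrier = A \<rightarrow>\<^sub>E carrier M,
     mult = undefined, one = undefined,
     zero = (\<lambda>p\<in>A. \<zero>\<^bsub>M\<^esub>),
     add = (\<lambda>\<phi> \<psi>. \<lambda>p\<in>A. \<phi> p \<oplus>\<^bsub>M\<^esub> \<psi> p),
     smult = (\<lambda>c \<phi>. \<lambda>p\<in>A. c \<odot>\<^bsub>M\<^esub> \<phi> p)\<rparr>"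

lemma module_ext_fun_module:
  assumes "module R M"
  shows "module R (ext_fun_module A M)"
proof -
  interpret module R M by (rule assms)
  show ?thesis
  proof (rule module_criteria)
    show "cring R" ..
    show "\<forall>\<phi>\<in>carrier (ext_fun_module A M). \<exists>\<psi>\<in>carrier (ext_fun_module A M).
        \<phi> \<oplus>\<^bsub>ext_fun_module A M\<^esub> \<psi> = \<zero>\<^bsub>ext_fun_module A M\<^esub>"
    proof
      fix \<phi> assume "\<phi> \<in> carrier (ext_fun_module A M)"
      then show "\<exists>\<psi>\<in>carrier (ext_fun_module A M).
          \<phi> \<oplus>\<^bsub>ext_fun_module A M\<^esub> \<psi> = \<zero>\<^bsub>ext_fun_module A M\<^esub>"
        by (intro bexI[of _ "\<lambda>p\<in>A. \<ominus>\<^bsub>M\<^esub> \<phi> p"])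
          (auto simp: ext_fun_module_def fun_eq_iff M.r_neg PiE_iff)
    qed
  qed (auto simp: ext_fun_module_def fun_eq_iff PiE_iff extensional_def M.a_ac
      smult_l_distr smult_r_distr smult_assoc1)
qed

lemma C2_module_eq: "C2_module K L = (ext_fun_module (carrier L \<times> carrier L) L)\<lparr>carrier := C2 K L\<rparr>"
  by (simp add: C2_module_def ext_fun_module_def)

text \<open>Linearity constrains a function only on the carrier. This is what allows replacing a
  function by its extensional restriction.\<close>

lemma module_hom_cong:
  assumes "f \<in> module_hom R M N" "\<And>v. v \<in> carrier M \<Longrightarrow> f v = g v" "module R M"
  shows "g \<in> module_hom R M N"
proof -
  interpret module R M by fact
  show ?thesis
    using assms(1,2) unfolding module_hom_def by (auto simp: Pi_iff)
qed

section \<open>Linear and bilinear maps on a module\<close>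

context module
begin

lemma module_hom_mem: "f \<in> module_hom R M M \<Longrightarrow> v \<in> carrier M \<Longrightarrow> f v \<in> carrier M"
  by (auto simp: module_hom_def)

lemma module_hom_finsum:
  assumes f: "f \<in> module_hom R M M" and I: "finite I"
    and c: "c \<in> I \<rightarrow> carrier R" and v: "v \<in> I \<rightarrow> carrier M"
  shows "f (\<Oplus>\<^bsub>M\<^esub>i\<in>I. c i \<odot>\<^bsub>M\<^esub> v i) = (\<Oplus>\<^bsub>M\<^esub>i\<in>I. c i \<odot>\<^bsub>M\<^esub> f (v i))"
proof -
  interpret mod_hom R M M f
    using f by unfold_locales
  show ?thesis using I c v
  proof (induction I rule: finite_induct)
    case (insert i I)
    then have mem: "c \<in> I \<rightarrow> carrier R" "v \<in> I \<rightarrow> carrier M" "c i \<in> carrier R" "v i \<in> carrier M"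
      by auto
    then have "(\<lambda>i. c i \<odot>\<^bsub>M\<^esub> v i) \<in> I \<rightarrow> carrier M" "(\<lambda>i. c i \<odot>\<^bsub>M\<^esub> f (v i)) \<in> I \<rightarrow> carrier M"
      by (auto simp: Pi_iff)
    with insert mem show ?case by (simp add: M.finsum_closed)
  qed simp
qed

lemma module_hom_zero: "(\<lambda>v. \<zero>\<^bsub>M\<^esub>) \<in> module_hom R M M"
  by (auto simp: module_hom_def)

lemma module_hom_plus:
  assumes "f \<in> module_hom R M M" "g \<in> module_hom R M M"
  shows "(\<lambda>v. f v \<oplus>\<^bsub>M\<^esub> g v) \<in> module_hom R M M"
  using assms by (auto simp: module_hom_def Pi_iff M.a_ac smult_r_distr)

lemma module_hom_minus:
  assumes "f \<in> module_hom R M M" "g \<in> module_hom R M M"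
  shows "(\<lambda>v. f v \<ominus>\<^bsub>M\<^esub> g v) \<in> module_hom R M M"
  using assms
  by (auto simp: module_hom_def Pi_iff M.a_ac smult_r_distr a_minus_def M.minus_add smult_r_minus)

lemma module_hom_scale:
  assumes "f \<in> module_hom R M M" "c \<in> carrier R"
  shows "(\<lambda>v. c \<odot>\<^bsub>M\<^esub> f v) \<in> module_hom R M M"
  using assms
  by (auto simp: module_hom_def Pi_iff smult_r_distr m_comm simp flip: smult_assoc1)

lemma module_hom_compose:
  assumes "f \<in> module_hom R M M" "g \<in> module_hom R M M"
  shows "(\<lambda>v. f (g v)) \<in> module_hom R M M"
  using assms by (auto simp: module_hom_def Pi_iff)

lemma bilinear_mapD:
  assumes "bilinear_map R M f"
  shows "v \<in> carrier M \<Longrightarrow> f v \<in> module_hom R M M"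
    "w \<in> carrier M \<Longrightarrow> (\<lambda>v. f v w) \<in> module_hom R M M"
  using assms by (auto simp: bilinear_map_def)

lemma bilinear_map_mem:
  assumes "bilinear_map R M f" "v \<in> carrier M" "w \<in> carrier M"
  shows "f v w \<in> carrier M"
  using bilinear_mapD(1)[OF assms(1,2)] assms(3) by (rule module_hom_mem)

lemma bilinear_map_add:
  assumes "bilinear_map R M f" "u \<in> carrier M" "v \<in> carrier M" "w \<in> carrier M"
  shows "f u (v \<oplus>\<^bsub>M\<^esub> w) = f u v \<oplus>\<^bsub>M\<^esub> f u w" "f (v \<oplus>\<^bsub>M\<^esub> w) u = f v u \<oplus>\<^bsub>M\<^esub> f w u"
  using bilinear_mapD[OF assms(1)] assms(2-) by (auto simp: module_hom_def)

lemma bilinear_map_smult: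
  assumes "bilinear_map R M f" "u \<in> carrier M" "v \<in> carrier M" "c \<in> carrier R"
  shows "f u (c \<odot>\<^bsub>M\<^esub> v) = c \<odot>\<^bsub>M\<^esub> f u v" "f (c \<odot>\<^bsub>M\<^esub> v) u = c \<odot>\<^bsub>M\<^esub> f v u"
  using bilinear_mapD[OF assms(1)] assms(2-) by (auto simp: module_hom_def)

lemma bilinear_map_zero:
  assumes "bilinear_map R M f" "u \<in> carrier M"
  shows "f u \<zero>\<^bsub>M\<^esub> = \<zero>\<^bsub>M\<^esub>" "f \<zero>\<^bsub>M\<^esub> u = \<zero>\<^bsub>M\<^esub>"
  using bilinear_map_smult[OF assms M.zero_closed R.zero_closed] assms
  by (auto simp: bilinear_map_mem)

lemma module_hom_at_zero: "f \<in> module_hom R M M \<Longrightarrow> f \<zero>\<^bsub>M\<^esub> = \<zero>\<^bsub>M\<^esub>"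
  using module_hom_smult[of f R M M "\<zero>\<^bsub>R\<^esub>" "\<zero>\<^bsub>M\<^esub>"] by (simp add: module_hom_mem)

lemma bilinear_map_cong:
  assumes "bilinear_map R M f"
    "\<And>v w. v \<in> carrier M \<Longrightarrow> w \<in> carrier M \<Longrightarrow> f v w = g v w"
  shows "bilinear_map R M g"
  unfolding bilinear_map_def
proof (intro conjI ballI)
  fix v assume v: "v \<in> carrier M"
  show "g v \<in> module_hom R M M"
    using bilinear_mapD(1)[OF assms(1) v] assms(2)[OF v] module_axioms by (rule module_hom_cong)
  show "(\<lambda>w. g w v) \<in> module_hom R M M"
    using bilinear_mapD(2)[OF assms(1) v] assms(2)[OF _ v] module_axioms by (rule module_hom_cong)
qed

section \<open>Submodules of cochains and cocycles\<close>

lemma mem_C2I: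
  assumes "bilinear_map R M f"
  shows "(\<lambda>(v, w)\<in>carrier M \<times> carrier M. f v w) \<in> C2 R M"
  unfolding C2_def
proof (intro CollectI conjI)
  show "(\<lambda>(v, w)\<in>carrier M \<times> carrier M. f v w) \<in> carrier M \<times> carrier M \<rightarrow>\<^sub>E carrier M"
    using bilinear_mapD(1)[OF assms] by (auto simp: module_hom_mem)
  show "bilinear_map R M (curry (\<lambda>(v, w)\<in>carrier M \<times> carrier M. f v w))"
    using assms by (rule bilinear_map_cong) simp
qed

lemma mem_C2D:
  assumes "\<phi> \<in> C2 R M"
  shows "bilinear_map R M (\<lambda>v w. \<phi> (v, w))" "\<phi> \<in> carrier M \<times> carrier M \<rightarrow>\<^sub>E carrier M"
    "\<And>v w. v \<in> carrier M \<Longrightarrow> w \<in> carrier M \<Longrightarrow> \<phi> (v, w) \<in> carrier M"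
  using assms by (auto simp: C2_def curry_def)

lemma submodule_C2: "submodule R (C2 R M) (ext_fun_module (carrier M \<times> carrier M) M)"
proof (rule LinearCombinations.submodule.intro)
  show "module R (ext_fun_module (carrier M \<times> carrier M) M)"
    using module_axioms by (rule module_ext_fun_module)
  show "C2 R M \<subseteq> carrier (ext_fun_module (carrier M \<times> carrier M) M)"
    by (auto simp: C2_def ext_fun_module_def)
  have "bilinear_map R M (\<lambda>v w. \<zero>\<^bsub>M\<^esub>)"
    by (simp add: bilinear_map_def module_hom_zero)
  from mem_C2I[OF this] show "\<zero>\<^bsub>ext_fun_module (carrier M \<times> carrier M) M\<^esub> \<in> C2 R M"
    by (simp add: ext_fun_module_def case_prod_beta')
next
  fix \<phi> \<psi> assume "\<phi> \<in> C2 R M" "\<psi> \<in> C2 R M"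
  note b = mem_C2D(1)[OF this(1)] mem_C2D(1)[OF this(2)]
  have "bilinear_map R M (\<lambda>v w. \<phi> (v, w) \<oplus>\<^bsub>M\<^esub> \<psi> (v, w))"
    using b unfolding bilinear_map_def by (auto intro: module_hom_plus)
  from mem_C2I[OF this] show "\<phi> \<oplus>\<^bsub>ext_fun_module (carrier M \<times> carrier M) M\<^esub> \<psi> \<in> C2 R M"
    by (simp add: ext_fun_module_def case_prod_beta')
next
  fix c \<phi> assume c: "c \<in> carrier R" and "\<phi> \<in> C2 R M"
  note b = mem_C2D(1)[OF this(2)]
  have "bilinear_map R M (\<lambda>v w. c \<odot>\<^bsub>M\<^esub> \<phi> (v, w))"
    using b c unfolding bilinear_map_def by (auto intro: module_hom_scale)
  from mem_C2I[OF this] show "c \<odot>\<^bsub>ext_fun_module (carrier M \<times> carrier M) M\<^esub> \<phi> \<in> C2 R M"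
    by (simp add: ext_fun_module_def case_prod_beta')
qed

lemma module_C2_module: "module R (C2_module R M)"
proof -
  interpret F: module R "ext_fun_module (carrier M \<times> carrier M) M"
    using module_axioms by (rule module_ext_fun_module)
  show ?thesis
    unfolding C2_module_eq by (rule F.submodule_is_module[OF submodule_C2])
qed

text \<open>The left-hand side of the cocycle identity is linear in the cochain, because the bracket
  is bilinear; cocycles form the kernel of this linear expression.\<close>

lemma submodule_ZL2:
  assumes br: "bilinear_map R M br"
  shows "submodule R (ZL2 R M br) (C2_module R M)"
proof -
  interpret C2: module R "C2_module R M" by (rule module_C2_module)
  note br_simps = bilinear_map_add[OF br] bilinear_map_smult[OF br] bilinear_map_zero[OF br]
    bilinear_map_mem[OF br]
  show ?thesis
  proof (rule LinearCombinations.submodule.intro)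
    show "module R (C2_module R M)" by (rule module_C2_module)
    show "ZL2 R M br \<subseteq> carrier (C2_module R M)"
      by (auto simp: ZL2_def C2_module_def)
    show "\<zero>\<^bsub>C2_module R M\<^esub> \<in> ZL2 R M br"
      using C2.M.zero_closed
      by (auto simp: ZL2_def C2_module_def br_simps a_minus_def M.a_inv_zero)
  next
    fix \<phi> \<psi> assume \<phi>: "\<phi> \<in> ZL2 R M br" and \<psi>: "\<psi> \<in> ZL2 R M br"
    then have C: "\<phi> \<in> C2 R M" "\<psi> \<in> C2 R M" by (auto simp: ZL2_def)
    note mem = mem_C2D(3)[OF C(1)] mem_C2D(3)[OF C(2)]
    have "\<phi> \<oplus>\<^bsub>C2_module R M\<^esub> \<psi> \<in> C2 R M"
      using C2.M.add.m_closed[of \<phi> \<psi>] C by (simp add: C2_module_def)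
    moreover
    \<comment> \<open>The expression for a sum is regrouped into the expressions for the two
      summands, each of which vanishes. The fact \<open>factor\<close> below does the same for
      scalars.\<close>
    have shuffle: "(a \<oplus>\<^bsub>M\<^esub> a') \<ominus>\<^bsub>M\<^esub> (b \<oplus>\<^bsub>M\<^esub> b') \<oplus>\<^bsub>M\<^esub> (c \<oplus>\<^bsub>M\<^esub> c') \<oplus>\<^bsub>M\<^esub> (d \<oplus>\<^bsub>M\<^esub> d') \<ominus>\<^bsub>M\<^esub> (e \<oplus>\<^bsub>M\<^esub> e')
          \<oplus>\<^bsub>M\<^esub> (f \<oplus>\<^bsub>M\<^esub> f') = (a \<ominus>\<^bsub>M\<^esub> b \<oplus>\<^bsub>M\<^esub> c \<oplus>\<^bsub>M\<^esub> d \<ominus>\<^bsub>M\<^esub> e \<oplus>\<^bsub>M\<^esub> f) \<oplus>\<^bsub>M\<^esub> (a' \<ominus>\<^bsub>M\<^esub> b' \<oplus>\<^bsub>M\<^esub> c' \<oplus>\<^bsub>M\<^esub> d' \<ominus>\<^bsub>M\<^esub> e' \<oplus>\<^bsub>M\<^esub> f')"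
      if "a \<in> carrier M" "b \<in> carrier M" "c \<in> carrier M" "d \<in> carrier M" "e \<in> carrier M" "f \<in> carrier M"
        "a' \<in> carrier M" "b' \<in> carrier M" "c' \<in> carrier M" "d' \<in> carrier M" "e' \<in> carrier M" "f' \<in> carrier M"
      for a b c d e f a' b' c' d' e' f'
      using that by algebra
    have "br x ((\<phi> \<oplus>\<^bsub>C2_module R M\<^esub> \<psi>) (y, z)) \<ominus>\<^bsub>M\<^esub> br ((\<phi> \<oplus>\<^bsub>C2_module R M\<^esub> \<psi>) (x, y)) z
        \<oplus>\<^bsub>M\<^esub> br ((\<phi> \<oplus>\<^bsub>C2_module R M\<^esub> \<psi>) (x, z)) y \<oplus>\<^bsub>M\<^esub> (\<phi> \<oplus>\<^bsub>C2_module R M\<^esub> \<psi>) (x, br y z)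
        \<ominus>\<^bsub>M\<^esub> (\<phi> \<oplus>\<^bsub>C2_module R M\<^esub> \<psi>) (br x y, z) \<oplus>\<^bsub>M\<^esub> (\<phi> \<oplus>\<^bsub>C2_module R M\<^esub> \<psi>) (br x z, y) = \<zero>\<^bsub>M\<^esub>"
      if "x \<in> carrier M" "y \<in> carrier M" "z \<in> carrier M" for x y z
      using that \<phi> \<psi> by (simp add: C2_module_def br_simps mem shuffle) (simp add: ZL2_def)
    ultimately show "\<phi> \<oplus>\<^bsub>C2_module R M\<^esub> \<psi> \<in> ZL2 R M br"
      by (simp add: ZL2_def)
  next
    fix r \<phi> assume r: "r \<in> carrier R" and \<phi>: "\<phi> \<in> ZL2 R M br"
    then have C: "\<phi> \<in> C2 R M" by (auto simp: ZL2_def)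
    note mem = mem_C2D(3)[OF C(1)]
    have "r \<odot>\<^bsub>C2_module R M\<^esub> \<phi> \<in> C2 R M"
      using C2.smult_closed[of r \<phi>] r C by (simp add: C2_module_def)
    moreover
    have factor: "r \<odot>\<^bsub>M\<^esub> a \<ominus>\<^bsub>M\<^esub> r \<odot>\<^bsub>M\<^esub> b \<oplus>\<^bsub>M\<^esub> r \<odot>\<^bsub>M\<^esub> c \<oplus>\<^bsub>M\<^esub> r \<odot>\<^bsub>M\<^esub> d \<ominus>\<^bsub>M\<^esub> r \<odot>\<^bsub>M\<^esub> e \<oplus>\<^bsub>M\<^esub> r \<odot>\<^bsub>M\<^esub> f
        = r \<odot>\<^bsub>M\<^esub> (a \<ominus>\<^bsub>M\<^esub> b \<oplus>\<^bsub>M\<^esub> c \<oplus>\<^bsub>M\<^esub> d \<ominus>\<^bsub>M\<^esub> e \<oplus>\<^bsub>M\<^esub> f)"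
      if "a \<in> carrier M" "b \<in> carrier M" "c \<in> carrier M" "d \<in> carrier M" "e \<in> carrier M" "f \<in> carrier M"
      for a b c d e f
      using that r by (simp add: smult_r_distr a_minus_def smult_r_minus)
    have "br x ((r \<odot>\<^bsub>C2_module R M\<^esub> \<phi>) (y, z)) \<ominus>\<^bsub>M\<^esub> br ((r \<odot>\<^bsub>C2_module R M\<^esub> \<phi>) (x, y)) z
        \<oplus>\<^bsub>M\<^esub> br ((r \<odot>\<^bsub>C2_module R M\<^esub> \<phi>) (x, z)) y \<oplus>\<^bsub>M\<^esub> (r \<odot>\<^bsub>C2_module R M\<^esub> \<phi>) (x, br y z)
        \<ominus>\<^bsub>M\<^esub> (r \<odot>\<^bsub>C2_module R M\<^esub> \<phi>) (br x y, z) \<oplus>\<^bsub>M\<^esub> (r \<odot>\<^bsub>C2_module R M\<^esub> \<phi>) (br x z, y) = \<zero>\<^bsub>M\<^esub>"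
      if "x \<in> carrier M" "y \<in> carrier M" "z \<in> carrier M" for x y z
      using that r \<phi> by (simp add: C2_module_def br_simps mem factor) (simp add: ZL2_def)
    ultimately show "r \<odot>\<^bsub>C2_module R M\<^esub> \<phi> \<in> ZL2 R M br"
      by (simp add: ZL2_def)
  qed
qed

lemma module_ZL2_module:
  assumes "bilinear_map R M br"
  shows "module R (ZL2_module R M br)"
proof -
  interpret C2: module R "C2_module R M" by (rule module_C2_module)
  show ?thesis
    unfolding ZL2_module_def by (rule C2.submodule_is_module[OF submodule_ZL2[OF assms]])
qed

lemma ZL2_module_simps:
  "carrier (ZL2_module R M br) = ZL2 R M br"
  "\<zero>\<^bsub>ZL2_module R M br\<^esub> = (\<lambda>p\<in>carrier M \<times> carrier M. \<zero>\<^bsub>M\<^esub>)"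
  "\<phi> \<oplus>\<^bsub>ZL2_module R M br\<^esub> \<psi> = (\<lambda>p\<in>carrier M \<times> carrier M. \<phi> p \<oplus>\<^bsub>M\<^esub> \<psi> p)"
  "c \<odot>\<^bsub>ZL2_module R M br\<^esub> \<phi> = (\<lambda>p\<in>carrier M \<times> carrier M. c \<odot>\<^bsub>M\<^esub> \<phi> p)"
  by (simp_all add: ZL2_module_def C2_module_def)

text \<open>Evaluation at a fixed pair is linear. Hence a combination of cocycles can be computed
  value by value in the algebra.\<close>

lemma ZL2_finsum_apply:
  assumes br: "bilinear_map R M br" and "finite I" "c \<in> I \<rightarrow> carrier R" "\<phi> \<in> I \<rightarrow> ZL2 R M br"
    and vw: "v \<in> carrier M" "w \<in> carrier M"
  shows "(\<Oplus>\<^bsub>ZL2_module R M br\<^esub>i\<in>I. c i \<odot>\<^bsub>ZL2_module R M br\<^esub> \<phi> i) (v, w)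
    = (\<Oplus>\<^bsub>M\<^esub>i\<in>I. c i \<odot>\<^bsub>M\<^esub> \<phi> i (v, w))"
proof -
  interpret Z: module R "ZL2_module R M br" by (rule module_ZL2_module[OF br])
  show ?thesis using assms(2-4)
  proof (induction I rule: finite_induct)
    case empty
    show ?case using vw by (simp add: ZL2_module_simps)
  next
    case (insert i I)
    then have mem: "c \<in> I \<rightarrow> carrier R" "\<phi> \<in> I \<rightarrow> ZL2 R M br" "c i \<in> carrier R" "\<phi> i \<in> ZL2 R M br"
      by auto
    have val: "\<psi> (v, w) \<in> carrier M" if "\<psi> \<in> ZL2 R M br" for \<psi>
      using that vw mem_C2D(3)[of \<psi>] by (simp add: ZL2_def)
    have Zmem: "c i \<odot>\<^bsub>ZL2_module R M br\<^esub> \<phi> i \<in> carrier (ZL2_module R M br)"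
      using mem by (intro Z.smult_closed) (auto simp: ZL2_module_simps(1))
    have ZI: "(\<lambda>i. c i \<odot>\<^bsub>ZL2_module R M br\<^esub> \<phi> i) \<in> I \<rightarrow> carrier (ZL2_module R M br)"
      using mem by (intro Pi_I Z.smult_closed) (auto simp: ZL2_module_simps(1))
    have "(\<Oplus>\<^bsub>ZL2_module R M br\<^esub>i\<in>insert i I. c i \<odot>\<^bsub>ZL2_module R M br\<^esub> \<phi> i) (v, w)
        = c i \<odot>\<^bsub>M\<^esub> \<phi> i (v, w) \<oplus>\<^bsub>M\<^esub> (\<Oplus>\<^bsub>ZL2_module R M br\<^esub>i\<in>I. c i \<odot>\<^bsub>ZL2_module R M br\<^esub> \<phi> i) (v, w)"
      using vw by (subst Z.finsum_insert[OF insert.hyps ZI Zmem]) (simp add: ZL2_module_simps(3,4))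
    also have "\<dots> = c i \<odot>\<^bsub>M\<^esub> \<phi> i (v, w) \<oplus>\<^bsub>M\<^esub> (\<Oplus>\<^bsub>M\<^esub>i\<in>I. c i \<odot>\<^bsub>M\<^esub> \<phi> i (v, w))"
      using insert.IH mem by simp
    also have "\<dots> = (\<Oplus>\<^bsub>M\<^esub>i\<in>insert i I. c i \<odot>\<^bsub>M\<^esub> \<phi> i (v, w))"
      using mem val by (subst M.finsum_insert[OF insert.hyps]) (auto simp: Pi_iff)
    finally show ?case .
  qed
qed

section \<open>The coboundary operator\<close>

lemma d1_apply:
  assumes "v \<in> carrier M" "w \<in> carrier M"
  shows "d1 M br f (v, w) = br v (f w) \<oplus>\<^bsub>M\<^esub> br (f v) w \<ominus>\<^bsub>M\<^esub> f (br v w)"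
  using assms by (simp add: d1_def)

lemma d1_mem_C2:
  assumes br: "bilinear_map R M br" and f: "f \<in> module_hom R M M"
  shows "d1 M br f \<in> C2 R M"
  unfolding d1_def
proof (rule mem_C2I)
  note b = bilinear_mapD[OF br]
  show "bilinear_map R M (\<lambda>v w. br v (f w) \<oplus>\<^bsub>M\<^esub> br (f v) w \<ominus>\<^bsub>M\<^esub> f (br v w))"
    unfolding bilinear_map_def
  proof (intro conjI ballI)
    fix v assume v: "v \<in> carrier M"
    then have fv: "f v \<in> carrier M" using f by (simp add: module_hom_mem)
    show "(\<lambda>w. br v (f w) \<oplus>\<^bsub>M\<^esub> br (f v) w \<ominus>\<^bsub>M\<^esub> f (br v w)) \<in> module_hom R M M"
      by (intro module_hom_minus module_hom_plus b(1)[OF fv] module_hom_compose[OF b(1)[OF v] f]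
          module_hom_compose[OF f b(1)[OF v]])
    show "(\<lambda>w. br w (f v) \<oplus>\<^bsub>M\<^esub> br (f w) v \<ominus>\<^bsub>M\<^esub> f (br w v)) \<in> module_hom R M M"
      by (intro module_hom_minus module_hom_plus b(2)[OF fv] module_hom_compose[OF b(2)[OF v] f]
          module_hom_compose[OF f b(2)[OF v]])
  qed
qed

end

text \<open>The operator \<open>d1 M br\<close> is linear in its argument, so its image is closed
  under the module operations. That coboundaries are cocycles is assumed here, as it depends on the
  particular bracket and not on bilinearity alone.\<close>

lemma (in module) submodule_BL2:
  assumes br: "bilinear_map R M br" and Z: "BL2 R M br \<subseteq> ZL2 R M br"
  shows "submodule R (BL2 R M br) (ZL2_module R M br)"
proof (rule LinearCombinations.submodule.intro)
  show "module R (ZL2_module R M br)" by (rule module_ZL2_module[OF br])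
  show "BL2 R M br \<subseteq> carrier (ZL2_module R M br)" using Z by (simp add: ZL2_module_simps)
  have "\<zero>\<^bsub>ZL2_module R M br\<^esub> = d1 M br (\<lambda>v. \<zero>\<^bsub>M\<^esub>)"
    by (auto simp: fun_eq_iff d1_def ZL2_module_simps restrict_def bilinear_map_zero[OF br] a_minus_def M.a_inv_zero)
  then show "\<zero>\<^bsub>ZL2_module R M br\<^esub> \<in> BL2 R M br"
    unfolding BL2_def using module_hom_zero by blast
next
  fix \<phi> \<psi> assume "\<phi> \<in> BL2 R M br" "\<psi> \<in> BL2 R M br"
  then obtain f g where f: "f \<in> module_hom R M M" "\<phi> = d1 M br f"
    and g: "g \<in> module_hom R M M" "\<psi> = d1 M br g"
    unfolding BL2_def by blast
  have shuffle: "(a \<oplus>\<^bsub>M\<^esub> b \<ominus>\<^bsub>M\<^esub> c) \<oplus>\<^bsub>M\<^esub> (a' \<oplus>\<^bsub>M\<^esub> b' \<ominus>\<^bsub>M\<^esub> c')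
      = (a \<oplus>\<^bsub>M\<^esub> a') \<oplus>\<^bsub>M\<^esub> (b \<oplus>\<^bsub>M\<^esub> b') \<ominus>\<^bsub>M\<^esub> (c \<oplus>\<^bsub>M\<^esub> c')"
    if "a \<in> carrier M" "b \<in> carrier M" "c \<in> carrier M" "a' \<in> carrier M" "b' \<in> carrier M" "c' \<in> carrier M"
    for a b c a' b' c'
    using that by algebra
  have "\<phi> \<oplus>\<^bsub>ZL2_module R M br\<^esub> \<psi> = d1 M br (\<lambda>v. f v \<oplus>\<^bsub>M\<^esub> g v)"
    using f g by (auto simp: fun_eq_iff d1_def ZL2_module_simps restrict_def
        bilinear_map_add[OF br] bilinear_map_mem[OF br] module_hom_mem shuffle)
  then show "\<phi> \<oplus>\<^bsub>ZL2_module R M br\<^esub> \<psi> \<in> BL2 R M br"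
    unfolding BL2_def using module_hom_plus[OF f(1) g(1)] by blast
next
  fix c \<phi> assume c: "c \<in> carrier R" and "\<phi> \<in> BL2 R M br"
  then obtain f where f: "f \<in> module_hom R M M" "\<phi> = d1 M br f"
    unfolding BL2_def by blast
  have "c \<odot>\<^bsub>ZL2_module R M br\<^esub> \<phi> = d1 M br (\<lambda>v. c \<odot>\<^bsub>M\<^esub> f v)"
    using f c by (auto simp: fun_eq_iff d1_def ZL2_module_simps restrict_def
        bilinear_map_smult[OF br] bilinear_map_mem[OF br] module_hom_mem smult_r_distr a_minus_def smult_r_minus)
  then show "c \<odot>\<^bsub>ZL2_module R M br\<^esub> \<phi> \<in> BL2 R M br"
    unfolding BL2_def using module_hom_scale[OF f(1) c] by blast
qed

section \<open>The null-filiform algebra\<close>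

declare One_nat_def [simp del]

section \<open>Coordinates with respect to the distinguished basis\<close>

context null_filiform
begin

text \<open>The description ranges over extensional families, since values outside the index range
  would otherwise be arbitrary and the description would not be unique.\<close>

definition coord :: "'v \<Rightarrow> nat \<Rightarrow> 'k" where
  "coord v = (THE a. a \<in> {1..n} \<rightarrow>\<^sub>E carrier K \<and> (\<Oplus>\<^bsub>L\<^esub>i\<in>{1..n}. a i \<odot>\<^bsub>L\<^esub> x i) = v)"

lemma x_mem: "i \<in> {1..n} \<Longrightarrow> x i \<in> carrier L"
  using basis_x unfolding basis_def by blast

lemma ex1_coord:
  assumes "v \<in> carrier L"
  shows "\<exists>!a. a \<in> {1..n} \<rightarrow>\<^sub>E carrier K \<and> (\<Oplus>\<^bsub>L\<^esub>i\<in>{1..n}. a i \<odot>\<^bsub>L\<^esub> x i) = v"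
proof -
  have "x \<in> {1..n} \<rightarrow> carrier L" using x_mem by blast
  from basis_family_iff[OF finite_atLeastAtMost this] basis_inj basis_x assms show ?thesis by blast
qed

lemma coord_mem:
  assumes "v \<in> carrier L" "i \<in> {1..n}"
  shows "coord v i \<in> carrier K"
  using theI'[OF ex1_coord[OF assms(1)], folded coord_def] assms(2) by blast

lemma coord_sum:
  assumes "v \<in> carrier L"
  shows "(\<Oplus>\<^bsub>L\<^esub>i\<in>{1..n}. coord v i \<odot>\<^bsub>L\<^esub> x i) = v"
  using theI'[OF ex1_coord[OF assms(1)], folded coord_def] by blast

lemma comb_mem:
  assumes "a \<in> {1..n} \<rightarrow> carrier K"
  shows "(\<Oplus>\<^bsub>L\<^esub>i\<in>{1..n}. a i \<odot>\<^bsub>L\<^esub> x i) \<in> carrier L"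
  using assms x_mem by (intro M.finsum_closed) (auto simp: Pi_iff)

lemma coord_comb:
  assumes a: "a \<in> {1..n} \<rightarrow> carrier K" and i: "i \<in> {1..n}"
  shows "coord (\<Oplus>\<^bsub>L\<^esub>i\<in>{1..n}. a i \<odot>\<^bsub>L\<^esub> x i) i = a i"
proof -
  have "(\<Oplus>\<^bsub>L\<^esub>i\<in>{1..n}. restrict a {1..n} i \<odot>\<^bsub>L\<^esub> x i) = (\<Oplus>\<^bsub>L\<^esub>i\<in>{1..n}. a i \<odot>\<^bsub>L\<^esub> x i)"
    using a x_mem by (intro M.finsum_cong') (auto simp: Pi_iff)
  then have "coord (\<Oplus>\<^bsub>L\<^esub>i\<in>{1..n}. a i \<odot>\<^bsub>L\<^esub> x i) = restrict a {1..n}"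
    unfolding coord_def by (intro the1_equality ex1_coord[OF comb_mem[OF a]]) (use a in auto)
  with i show ?thesis by simp
qed

lemma coord_add:
  assumes "v \<in> carrier L" "w \<in> carrier L" "i \<in> {1..n}"
  shows "coord (v \<oplus>\<^bsub>L\<^esub> w) i = coord v i \<oplus>\<^bsub>K\<^esub> coord w i"
proof -
  have "v \<oplus>\<^bsub>L\<^esub> w = (\<Oplus>\<^bsub>L\<^esub>i\<in>{1..n}. coord v i \<odot>\<^bsub>L\<^esub> x i) \<oplus>\<^bsub>L\<^esub> (\<Oplus>\<^bsub>L\<^esub>i\<in>{1..n}. coord w i \<odot>\<^bsub>L\<^esub> x i)"
    using assms coord_sum by simp
  also have "\<dots> = (\<Oplus>\<^bsub>L\<^esub>i\<in>{1..n}. coord v i \<odot>\<^bsub>L\<^esub> x i \<oplus>\<^bsub>L\<^esub> coord w i \<odot>\<^bsub>L\<^esub> x i)"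
    using assms x_mem coord_mem by (intro M.finsum_addf[symmetric]) auto
  also have "\<dots> = (\<Oplus>\<^bsub>L\<^esub>i\<in>{1..n}. (coord v i \<oplus>\<^bsub>K\<^esub> coord w i) \<odot>\<^bsub>L\<^esub> x i)"
    using assms x_mem coord_mem by (intro M.finsum_cong') (auto simp: smult_l_distr)
  finally show ?thesis
    using coord_comb[of "\<lambda>i. coord v i \<oplus>\<^bsub>K\<^esub> coord w i"] assms coord_mem by simp
qed

lemma coord_smult:
  assumes "c \<in> carrier K" "v \<in> carrier L" "i \<in> {1..n}"
  shows "coord (c \<odot>\<^bsub>L\<^esub> v) i = c \<otimes>\<^bsub>K\<^esub> coord v i"
proof -
  have "c \<odot>\<^bsub>L\<^esub> v = c \<odot>\<^bsub>L\<^esub> (\<Oplus>\<^bsub>L\<^esub>i\<in>{1..n}. coord v i \<odot>\<^bsub>L\<^esub> x i)"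
    using assms coord_sum by simp
  also have "\<dots> = (\<Oplus>\<^bsub>L\<^esub>i\<in>{1..n}. c \<odot>\<^bsub>L\<^esub> (coord v i \<odot>\<^bsub>L\<^esub> x i))"
    using assms x_mem coord_mem by (intro finsum_smult_ldistr) auto
  also have "\<dots> = (\<Oplus>\<^bsub>L\<^esub>i\<in>{1..n}. (c \<otimes>\<^bsub>K\<^esub> coord v i) \<odot>\<^bsub>L\<^esub> x i)"
    using assms x_mem coord_mem by (intro M.finsum_cong') (auto simp: smult_assoc1)
  finally show ?thesis
    using coord_comb[of "\<lambda>i. c \<otimes>\<^bsub>K\<^esub> coord v i"] assms coord_mem by simp
qed

lemma coord_x:
  assumes "i \<in> {1..n}" "j \<in> {1..n}"
  shows "coord (x j) i = (if i = j then \<one>\<^bsub>K\<^esub> else \<zero>\<^bsub>K\<^esub>)"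
proof -
  have "x \<in> {1..n} \<rightarrow> carrier L" using x_mem by blast
  from finsum_delta[OF finite_atLeastAtMost assms(2) this]
    coord_comb[of "\<lambda>i. if i = j then \<one>\<^bsub>K\<^esub> else \<zero>\<^bsub>K\<^esub>" i] assms(1)
  show ?thesis by simp
qed

lemma coord_zero: "i \<in> {1..n} \<Longrightarrow> coord \<zero>\<^bsub>L\<^esub> i = \<zero>\<^bsub>K\<^esub>"
  using coord_smult[of "\<zero>\<^bsub>K\<^esub>" "\<zero>\<^bsub>L\<^esub>" i] coord_mem by simp

lemma coord_uminus:
  assumes "v \<in> carrier L" "i \<in> {1..n}"
  shows "coord (\<ominus>\<^bsub>L\<^esub> v) i = \<ominus>\<^bsub>K\<^esub> coord v i"
  using coord_add[of "\<ominus>\<^bsub>L\<^esub> v" v i] assms coord_mem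
  by (simp add: M.l_neg coord_zero R.minus_equality)

lemma coord_minus:
  assumes "v \<in> carrier L" "w \<in> carrier L" "i \<in> {1..n}"
  shows "coord (v \<ominus>\<^bsub>L\<^esub> w) i = coord v i \<ominus>\<^bsub>K\<^esub> coord w i"
  using assms by (simp add: a_minus_def coord_add coord_uminus)

text \<open>A coordinate takes values in \<open>K\<close>, while \<open>module_hom K L L\<close>
  contains only endomorphisms. Multiplying by a fixed vector turns the functional into an
  endomorphism, so the facts about endomorphisms apply to coordinates too.\<close>

lemma coord_module_hom:
  assumes "y \<in> carrier L" "i \<in> {1..n}"
  shows "(\<lambda>v. coord v i \<odot>\<^bsub>L\<^esub> y) \<in> module_hom K L L"
  using assms coord_mem
  by (auto simp: module_hom_def coord_add coord_smult smult_l_distr smult_assoc1)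

lemma module_hom_eqI:
  assumes f: "f \<in> module_hom K L L" and g: "g \<in> module_hom K L L"
    and eq: "\<And>i. i \<in> {1..n} \<Longrightarrow> f (x i) = g (x i)" and v: "v \<in> carrier L"
  shows "f v = g v"
proof -
  have c: "coord v \<in> {1..n} \<rightarrow> carrier K" and X: "x \<in> {1..n} \<rightarrow> carrier L"
    using v coord_mem x_mem by auto
  have "f v = (\<Oplus>\<^bsub>L\<^esub>i\<in>{1..n}. coord v i \<odot>\<^bsub>L\<^esub> f (x i))"
    using module_hom_finsum[OF f finite_atLeastAtMost c X] coord_sum[OF v] by simp
  also have "\<dots> = (\<Oplus>\<^bsub>L\<^esub>i\<in>{1..n}. coord v i \<odot>\<^bsub>L\<^esub> g (x i))"
    using c X g by (intro M.finsum_cong') (auto simp: eq module_hom_mem Pi_iff)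
  also have "\<dots> = g v"
    using module_hom_finsum[OF g finite_atLeastAtMost c X] coord_sum[OF v] by simp
  finally show ?thesis .
qed

lemma ex_module_hom:
  assumes y: "y \<in> {1..n} \<rightarrow> carrier L"
  shows "\<exists>f\<in>module_hom K L L. \<forall>i\<in>{1..n}. f (x i) = y i"
proof
  let ?f = "\<lambda>v. \<Oplus>\<^bsub>L\<^esub>i\<in>{1..n}. coord v i \<odot>\<^bsub>L\<^esub> y i"
  have mem: "(\<lambda>i. coord v i \<odot>\<^bsub>L\<^esub> y i) \<in> {1..n} \<rightarrow> carrier L" if "v \<in> carrier L" for v
    using that y coord_mem by auto
  have add: "?f (v \<oplus>\<^bsub>L\<^esub> w) = ?f v \<oplus>\<^bsub>L\<^esub> ?f w" if "v \<in> carrier L" "w \<in> carrier L" for v w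
  proof -
    have "?f (v \<oplus>\<^bsub>L\<^esub> w) = (\<Oplus>\<^bsub>L\<^esub>i\<in>{1..n}. coord v i \<odot>\<^bsub>L\<^esub> y i \<oplus>\<^bsub>L\<^esub> coord w i \<odot>\<^bsub>L\<^esub> y i)"
      using that y coord_mem by (intro M.finsum_cong') (auto simp: coord_add smult_l_distr Pi_iff)
    also have "\<dots> = ?f v \<oplus>\<^bsub>L\<^esub> ?f w"
      using mem that by (intro M.finsum_addf) auto
    finally show ?thesis .
  qed
  have smult: "?f (c \<odot>\<^bsub>L\<^esub> v) = c \<odot>\<^bsub>L\<^esub> ?f v" if "c \<in> carrier K" "v \<in> carrier L" for c v
  proof -
    have "?f (c \<odot>\<^bsub>L\<^esub> v) = (\<Oplus>\<^bsub>L\<^esub>i\<in>{1..n}. c \<odot>\<^bsub>L\<^esub> (coord v i \<odot>\<^bsub>L\<^esub> y i))"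
      using that y coord_mem by (intro M.finsum_cong') (auto simp: coord_smult smult_assoc1 Pi_iff)
    also have "\<dots> = c \<odot>\<^bsub>L\<^esub> ?f v"
      using mem that by (intro finsum_smult_ldistr[symmetric]) auto
    finally show ?thesis .
  qed
  show "?f \<in> module_hom K L L"
    using mem by (auto simp: module_hom_def add smult intro: M.finsum_closed)
  show "\<forall>j\<in>{1..n}. ?f (x j) = y j"
  proof
    fix j assume j: "j \<in> {1..n}"
    have "?f (x j) = (\<Oplus>\<^bsub>L\<^esub>i\<in>{1..n}. (if i = j then \<one>\<^bsub>K\<^esub> else \<zero>\<^bsub>K\<^esub>) \<odot>\<^bsub>L\<^esub> y i)"
      using y j by (intro M.finsum_cong') (auto simp: coord_x Pi_iff)
    with finsum_delta[OF finite_atLeastAtMost j y] show "?f (x j) = y j" by simp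
  qed
qed

text \<open>Agreement on the basis is extended first in the left argument and then in the right one.
  Extensionality settles all arguments outside the carrier.\<close>

lemma C2_eqI:
  assumes \<phi>: "\<phi> \<in> C2 K L" and \<psi>: "\<psi> \<in> C2 K L"
    and eq: "\<And>i j. i \<in> {1..n} \<Longrightarrow> j \<in> {1..n} \<Longrightarrow> \<phi> (x i, x j) = \<psi> (x i, x j)"
  shows "\<phi> = \<psi>"
proof (rule PiE_ext[OF mem_C2D(2)[OF \<phi>] mem_C2D(2)[OF \<psi>]])
  note b = bilinear_mapD[OF mem_C2D(1)[OF \<phi>]] bilinear_mapD[OF mem_C2D(1)[OF \<psi>]]
  have 1: "\<phi> (v, x j) = \<psi> (v, x j)" if "v \<in> carrier L" "j \<in> {1..n}" for v j
    using b(2)[OF x_mem[OF that(2)]] b(4)[OF x_mem[OF that(2)]] eq[OF _ that(2)] that(1)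
    by (rule module_hom_eqI)
  have 2: "\<phi> (v, w) = \<psi> (v, w)" if "v \<in> carrier L" "w \<in> carrier L" for v w
    using b(1)[OF that(1)] b(3)[OF that(1)] 1[OF that(1)] that(2)
    by (rule module_hom_eqI)
  fix p assume "p \<in> carrier L \<times> carrier L"
  then show "\<phi> p = \<psi> p" using 2 by auto
qed

section \<open>The bracket expressed by the shift operator and the first coordinate\<close>

definition shift :: "'v \<Rightarrow> 'v" where
  "shift v = br v (x 1)"

context
  assumes n: "2 \<le> n"
begin

lemma one_mem: "1 \<in> {1..n}" and n_mem: "n \<in> {1..n}"
  using n by auto

lemma shift_module_hom: "shift \<in> module_hom K L L"
  using bilinear_mapD(2)[OF bracket_bilinear x_mem[OF one_mem]] by (simp add: shift_def[abs_def])

lemma shift_x: "i \<in> {1..n} \<Longrightarrow> shift (x i) = (if i < n then x (i + 1) else \<zero>\<^bsub>L\<^esub>)"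
  using bracket_x[OF _ one_mem] by (simp add: shift_def)

lemma shift_mem: "v \<in> carrier L \<Longrightarrow> shift v \<in> carrier L"
  using shift_module_hom by (rule module_hom_mem)

text \<open>The second argument matters only through its first coordinate, because right
  multiplication by any other basis vector is zero. All later computations replace the bracket by
  this formula.\<close>

lemma br_eq:
  assumes v: "v \<in> carrier L" and w: "w \<in> carrier L"
  shows "br v w = coord w 1 \<odot>\<^bsub>L\<^esub> shift v"
proof (rule module_hom_eqI[OF bilinear_mapD(1)[OF bracket_bilinear v]
      coord_module_hom[OF shift_mem[OF v] one_mem] _ w])
  fix j assume j: "j \<in> {1..n}"
  \<comment> \<open>For \<open>j\<close> other than 1, right multiplication by \<open>x j\<close> is
    a linear map that vanishes on every basis vector.\<close>
  have "br v (x j) = \<zero>\<^bsub>L\<^esub>" if "j \<noteq> 1"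
    using bilinear_mapD(2)[OF bracket_bilinear x_mem[OF j]] module_hom_zero _ v
    by (rule module_hom_eqI) (use bracket_x j that in auto)
  then show "br v (x j) = coord (x j) 1 \<odot>\<^bsub>L\<^esub> shift v"
    using j v coord_x[OF one_mem j] by (auto simp: shift_def[symmetric] shift_mem)
qed

lemma smult_x_cancel:
  assumes "a \<in> carrier K" "b \<in> carrier K" "i \<in> {1..n}" "a \<odot>\<^bsub>L\<^esub> x i = b \<odot>\<^bsub>L\<^esub> x i"
  shows "a = b"
proof -
  have "coord (c \<odot>\<^bsub>L\<^esub> x i) i = c" if "c \<in> carrier K" for c
    using that assms(3) by (simp add: coord_smult coord_x x_mem del: atLeastAtMost_iff)
  with assms show ?thesis by metis
qed

text \<open>Both sides are scalar functionals of \<open>v\<close>. They are compared on the basis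
  after multiplication by \<open>x 1\<close>, which makes them endomorphisms, and the factor is then
  cancelled by \<open>smult_x_cancel\<close>.\<close>

lemma coord_shift:
  assumes v: "v \<in> carrier L" and i: "i \<in> {1..n}"
  shows "coord (shift v) i = (if i = 1 then \<zero>\<^bsub>K\<^esub> else coord v (i - 1))"
proof -
  have hom: "(\<lambda>v. (if i = 1 then \<zero>\<^bsub>K\<^esub> else coord v (i - 1)) \<odot>\<^bsub>L\<^esub> x 1) \<in> module_hom K L L"
  proof (cases "i = 1")
    case True
    then show ?thesis using module_hom_zero x_mem[OF one_mem] by simp
  next
    case False
    then have "i - 1 \<in> {1..n}" using i by auto
    then show ?thesis using False coord_module_hom[OF x_mem[OF one_mem]] by simp
  qed
  have "coord (shift v) i \<odot>\<^bsub>L\<^esub> x 1 = (if i = 1 then \<zero>\<^bsub>K\<^esub> else coord v (i - 1)) \<odot>\<^bsub>L\<^esub> x 1"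
    using module_hom_compose[OF coord_module_hom[OF x_mem[OF one_mem] i] shift_module_hom] hom _ v
  proof (rule module_hom_eqI)
    fix j assume j: "j \<in> {1..n}"
    then have "coord (shift (x j)) i = (if i = 1 then \<zero>\<^bsub>K\<^esub> else coord (x j) (i - 1))"
    proof (cases "i = 1")
      case True
      then show ?thesis using i j by (auto simp: shift_x coord_x coord_zero)
    next
      case False
      then have "i - 1 \<in> {1..n}" using i by auto
      with False i j show ?thesis by (auto simp: shift_x coord_x coord_zero)
    qed
    then show "coord (shift (x j)) i \<odot>\<^bsub>L\<^esub> x 1
        = (if i = 1 then \<zero>\<^bsub>K\<^esub> else coord (x j) (i - 1)) \<odot>\<^bsub>L\<^esub> x 1" by simp
  qed
  moreover have "(if i = 1 then \<zero>\<^bsub>K\<^esub> else coord v (i - 1)) \<in> carrier K"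
    using v i by (auto intro!: coord_mem)
  ultimately show ?thesis
    using smult_x_cancel[OF _ _ one_mem] coord_mem[OF shift_mem[OF v] i] by blast
qed

lemma coord_shift_one: "v \<in> carrier L \<Longrightarrow> coord (shift v) 1 = \<zero>\<^bsub>K\<^esub>"
  using coord_shift[OF _ one_mem] by simp

text \<open>In the cocycle identity the first and the fourth term vanish, because neither a value of
  \<open>g\<close> nor a bracket has a first coordinate. The remaining four cancel in two pairs,
  being symmetric in the last two arguments.\<close>

lemma right_functional_mem_ZL2:
  assumes g: "g \<in> module_hom K L L" and g1: "\<And>v. v \<in> carrier L \<Longrightarrow> coord (g v) 1 = \<zero>\<^bsub>K\<^esub>"
  shows "(\<lambda>(v, w)\<in>carrier L \<times> carrier L. coord w 1 \<odot>\<^bsub>L\<^esub> g v) \<in> ZL2 K L br"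
proof -
  note gm = module_hom_mem[OF g]
  have "bilinear_map K L (\<lambda>v w. coord w 1 \<odot>\<^bsub>L\<^esub> g v)"
    unfolding bilinear_map_def
    using coord_module_hom[OF gm one_mem] module_hom_scale[OF g coord_mem[OF _ one_mem]] by blast
  then have C: "(\<lambda>(v, w)\<in>carrier L \<times> carrier L. coord w 1 \<odot>\<^bsub>L\<^esub> g v) \<in> C2 K L"
    by (rule mem_C2I)
  have collapse: "\<zero>\<^bsub>L\<^esub> \<ominus>\<^bsub>L\<^esub> a \<oplus>\<^bsub>L\<^esub> a \<ominus>\<^bsub>L\<^esub> b \<oplus>\<^bsub>L\<^esub> b = \<zero>\<^bsub>L\<^esub>"
    if "a \<in> carrier L" "b \<in> carrier L" for a b
    using that by algebra
  show ?thesis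
    unfolding ZL2_def
  proof (intro CollectI conjI C ballI)
    fix u v w assume mem: "u \<in> carrier L" "v \<in> carrier L" "w \<in> carrier L"
    note e = coord_mem[OF mem(1) one_mem] coord_mem[OF mem(2) one_mem] coord_mem[OF mem(3) one_mem]
    have T: "shift (coord v 1 \<odot>\<^bsub>L\<^esub> g u) = coord v 1 \<odot>\<^bsub>L\<^esub> shift (g u)"
      "shift (coord w 1 \<odot>\<^bsub>L\<^esub> g u) = coord w 1 \<odot>\<^bsub>L\<^esub> shift (g u)"
      "g (coord v 1 \<odot>\<^bsub>L\<^esub> shift u) = coord v 1 \<odot>\<^bsub>L\<^esub> g (shift u)"
      "g (coord w 1 \<odot>\<^bsub>L\<^esub> shift u) = coord w 1 \<odot>\<^bsub>L\<^esub> g (shift u)"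
      using mem e gm shift_mem g shift_module_hom by (simp_all add: module_hom_smult)
    let ?\<phi> = "\<lambda>(v, w)\<in>carrier L \<times> carrier L. coord w 1 \<odot>\<^bsub>L\<^esub> g v"
    have swap: "coord w 1 \<odot>\<^bsub>L\<^esub> (coord v 1 \<odot>\<^bsub>L\<^esub> y) = coord v 1 \<odot>\<^bsub>L\<^esub> (coord w 1 \<odot>\<^bsub>L\<^esub> y)"
      if "y \<in> carrier L" for y
      using that e by (simp add: m_comm flip: smult_assoc1)
    show "br u (?\<phi> (v, w)) \<ominus>\<^bsub>L\<^esub> br (?\<phi> (u, v)) w \<oplus>\<^bsub>L\<^esub> br (?\<phi> (u, w)) v
        \<oplus>\<^bsub>L\<^esub> ?\<phi> (u, br v w) \<ominus>\<^bsub>L\<^esub> ?\<phi> (br u v, w) \<oplus>\<^bsub>L\<^esub> ?\<phi> (br u w, v) = \<zero>\<^bsub>L\<^esub>"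
      using mem e gm one_mem
      by (simp add: br_eq shift_mem coord_smult g1 coord_shift_one T swap collapse)
  qed
qed

section \<open>Coboundaries are cocycles\<close>

lemma d1_eq:
  assumes f: "f \<in> module_hom K L L" and v: "v \<in> carrier L" and w: "w \<in> carrier L"
  shows "d1 L br f (v, w) =
    coord (f w) 1 \<odot>\<^bsub>L\<^esub> shift v \<oplus>\<^bsub>L\<^esub> coord w 1 \<odot>\<^bsub>L\<^esub> shift (f v) \<ominus>\<^bsub>L\<^esub> coord w 1 \<odot>\<^bsub>L\<^esub> f (shift v)"
  using assms one_mem
  by (simp add: d1_apply br_eq module_hom_mem[OF f] shift_mem coord_mem module_hom_smult[OF f])

text \<open>By \<open>br_eq\<close> each of the six terms is a combination of the vectors
  \<open>?A\<close> to \<open>?E\<close>, whose coefficients are products of the scalars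
  \<open>p\<close>, \<open>q\<close>, \<open>a\<close>, \<open>b\<close>, \<open>c\<close>. The
  equations \<open>T1\<close> to \<open>T6\<close> record these combinations, and their alternating
  sum cancels formally.\<close>

lemma d1_mem_ZL2:
  assumes f: "f \<in> module_hom K L L"
  shows "d1 L br f \<in> ZL2 K L br"
  unfolding ZL2_def
proof (intro CollectI conjI ballI)
  show "d1 L br f \<in> C2 K L" by (rule d1_mem_C2[OF bracket_bilinear f])
  fix u v w assume mem: "u \<in> carrier L" "v \<in> carrier L" "w \<in> carrier L"
  note fm = module_hom_mem[OF f]
  interpret f: mod_hom K L L f using f by unfold_locales
  interpret s: mod_hom K L L shift using shift_module_hom by unfold_locales
  define p where "p = coord v 1"
  define q where "q = coord w 1"
  define a where "a = coord (f v) 1"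
  define b where "b = coord (f w) 1"
  define c where "c = coord (f (shift v)) 1"
  note K = coord_mem[OF mem(2) one_mem, folded p_def] coord_mem[OF mem(3) one_mem, folded q_def]
    coord_mem[OF fm[OF mem(2)] one_mem, folded a_def] coord_mem[OF fm[OF mem(3)] one_mem, folded b_def]
    coord_mem[OF fm[OF shift_mem[OF mem(2)]] one_mem, folded c_def]
  let ?A = "shift u" and ?B = "shift (shift u)" and ?C = "shift (shift (f u))"
    and ?D = "shift (f (shift u))" and ?E = "f (shift (shift u))"
  \<comment> \<open>Of the three summands given by \<open>d1_eq\<close>, two are multiples of
    shifted vectors and have no first coordinate. Only the one containing \<open>f (shift v)\<close>
    contributes.\<close>
  have "coord (d1 L br f (v, w)) 1 = \<ominus>\<^bsub>K\<^esub> (q \<otimes>\<^bsub>K\<^esub> c)"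
    using mem K one_mem
    by (simp add: d1_eq[OF f] coord_add coord_uminus coord_smult coord_shift_one shift_mem fm
        a_minus_def flip: p_def q_def a_def b_def c_def)
  then have T1: "br u (d1 L br f (v, w)) = \<ominus>\<^bsub>L\<^esub> ((q \<otimes>\<^bsub>K\<^esub> c) \<odot>\<^bsub>L\<^esub> ?A)"
    using mem K by (simp add: br_eq mem_C2D(3)[OF d1_mem_C2[OF bracket_bilinear f]] smult_l_minus shift_mem)
  have T2: "br (d1 L br f (u, v)) w = (q \<otimes>\<^bsub>K\<^esub> a) \<odot>\<^bsub>L\<^esub> ?B \<oplus>\<^bsub>L\<^esub> (p \<otimes>\<^bsub>K\<^esub> q) \<odot>\<^bsub>L\<^esub> ?C \<ominus>\<^bsub>L\<^esub> (p \<otimes>\<^bsub>K\<^esub> q) \<odot>\<^bsub>L\<^esub> ?D"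
    using mem K
    by (simp add: br_eq mem_C2D(3)[OF d1_mem_C2[OF bracket_bilinear f]] d1_eq[OF f] fm shift_mem
        smult_r_distr smult_r_minus smult_assoc1 a_minus_def m_comm[of p q] flip: p_def q_def a_def)
  have T3: "br (d1 L br f (u, w)) v = (p \<otimes>\<^bsub>K\<^esub> b) \<odot>\<^bsub>L\<^esub> ?B \<oplus>\<^bsub>L\<^esub> (p \<otimes>\<^bsub>K\<^esub> q) \<odot>\<^bsub>L\<^esub> ?C \<ominus>\<^bsub>L\<^esub> (p \<otimes>\<^bsub>K\<^esub> q) \<odot>\<^bsub>L\<^esub> ?D"
    using mem K
    by (simp add: br_eq mem_C2D(3)[OF d1_mem_C2[OF bracket_bilinear f]] d1_eq[OF f] fm shift_mem
        smult_r_distr smult_r_minus smult_assoc1 a_minus_def flip: p_def q_def b_def)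
  have T4: "d1 L br f (u, br v w) = (q \<otimes>\<^bsub>K\<^esub> c) \<odot>\<^bsub>L\<^esub> ?A"
    using mem K one_mem
    by (simp add: br_eq d1_eq[OF f] fm shift_mem coord_smult coord_shift_one a_minus_def M.a_inv_zero
        flip: q_def c_def)
  have T5: "d1 L br f (br u v, w) = (p \<otimes>\<^bsub>K\<^esub> b) \<odot>\<^bsub>L\<^esub> ?B \<oplus>\<^bsub>L\<^esub> (p \<otimes>\<^bsub>K\<^esub> q) \<odot>\<^bsub>L\<^esub> ?D \<ominus>\<^bsub>L\<^esub> (p \<otimes>\<^bsub>K\<^esub> q) \<odot>\<^bsub>L\<^esub> ?E"
    using mem K
    by (simp add: br_eq d1_eq[OF f] fm shift_mem m_comm[of p] flip: p_def q_def b_def smult_assoc1)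
  have T6: "d1 L br f (br u w, v) = (q \<otimes>\<^bsub>K\<^esub> a) \<odot>\<^bsub>L\<^esub> ?B \<oplus>\<^bsub>L\<^esub> (p \<otimes>\<^bsub>K\<^esub> q) \<odot>\<^bsub>L\<^esub> ?D \<ominus>\<^bsub>L\<^esub> (p \<otimes>\<^bsub>K\<^esub> q) \<odot>\<^bsub>L\<^esub> ?E"
    using mem K
    by (simp add: br_eq d1_eq[OF f] fm shift_mem m_comm[of q] flip: p_def q_def a_def smult_assoc1)
  \<comment> \<open>The variables stand for the distinct scaled vectors in \<open>T1\<close> to
    \<open>T6\<close>: the first and fourth term are opposite, and every other summand occurs with
    both signs.\<close>
  have cancel: "\<ominus>\<^bsub>L\<^esub> X1 \<ominus>\<^bsub>L\<^esub> (X2 \<oplus>\<^bsub>L\<^esub> X3 \<ominus>\<^bsub>L\<^esub> X4) \<oplus>\<^bsub>L\<^esub> (X5 \<oplus>\<^bsub>L\<^esub> X3 \<ominus>\<^bsub>L\<^esub> X4) \<oplus>\<^bsub>L\<^esub> X1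
      \<ominus>\<^bsub>L\<^esub> (X5 \<oplus>\<^bsub>L\<^esub> X4 \<ominus>\<^bsub>L\<^esub> X6) \<oplus>\<^bsub>L\<^esub> (X2 \<oplus>\<^bsub>L\<^esub> X4 \<ominus>\<^bsub>L\<^esub> X6) = \<zero>\<^bsub>L\<^esub>"
    if "X1 \<in> carrier L" "X2 \<in> carrier L" "X3 \<in> carrier L" "X4 \<in> carrier L" "X5 \<in> carrier L" "X6 \<in> carrier L"
    for X1 X2 X3 X4 X5 X6
    using that by algebra
  show "br u (d1 L br f (v, w)) \<ominus>\<^bsub>L\<^esub> br (d1 L br f (u, v)) w \<oplus>\<^bsub>L\<^esub> br (d1 L br f (u, w)) v
      \<oplus>\<^bsub>L\<^esub> d1 L br f (u, br v w) \<ominus>\<^bsub>L\<^esub> d1 L br f (br u v, w) \<oplus>\<^bsub>L\<^esub> d1 L br f (br u w, v) = \<zero>\<^bsub>L\<^esub>"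
    unfolding T1 T2 T3 T4 T5 T6 using mem K by (intro cancel) (simp_all add: shift_mem fm)
qed

lemma subspace_BL2: "subspace K (BL2 K L br) (ZL2_module K L br)"
proof -
  have "BL2 K L br \<subseteq> ZL2 K L br" using d1_mem_ZL2 by (auto simp: BL2_def)
  then show ?thesis
    unfolding subspace_def vectorspace_def
    using module_ZL2_module[OF bracket_bilinear] submodule_BL2[OF bracket_bilinear] field_axioms
    by blast
qed

section \<open>The cocycles supported at the last pair of basis vectors\<close>

text \<open>The explicit map has the prescribed values on the basis, and \<open>C2_eqI\<close> shows
  that no other cochain has them, so the definite description is resolved. The formula has the shape
  required by \<open>right_functional_mem_ZL2\<close>.\<close>

lemma nf_cocycle_eq:
  assumes k: "k \<in> {1..n}"
  shows "nf_cocycle K L n x k =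
    (\<lambda>(v, w)\<in>carrier L \<times> carrier L. coord w 1 \<odot>\<^bsub>L\<^esub> (coord v n \<odot>\<^bsub>L\<^esub> x k))" (is "_ = ?\<phi>")
  unfolding nf_cocycle_def
proof (rule the_equality)
  have hom: "(\<lambda>v. coord v n \<odot>\<^bsub>L\<^esub> x k) \<in> module_hom K L L"
    by (rule coord_module_hom[OF x_mem[OF k] n_mem])
  have "bilinear_map K L (\<lambda>v w. coord w 1 \<odot>\<^bsub>L\<^esub> (coord v n \<odot>\<^bsub>L\<^esub> x k))"
    unfolding bilinear_map_def
    using coord_module_hom[OF module_hom_mem[OF hom] one_mem]
      module_hom_scale[OF hom coord_mem[OF _ one_mem]] by blast
  then have "?\<phi> \<in> C2 K L" by (rule mem_C2I)
  moreover have "?\<phi> (x i, x j) = (if i = n \<and> j = 1 then x k else \<zero>\<^bsub>L\<^esub>)"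
    if "i \<in> {1..n}" "j \<in> {1..n}" for i j
    using x_mem[OF that(1)] x_mem[OF that(2)] x_mem[OF k]
      coord_x[OF n_mem that(1)] coord_x[OF one_mem that(2)] by auto
  ultimately show 1: "?\<phi> \<in> C2 K L \<and>
      (\<forall>i\<in>{1..n}. \<forall>j\<in>{1..n}. ?\<phi> (x i, x j) = (if i = n \<and> j = 1 then x k else \<zero>\<^bsub>L\<^esub>))"
    by blast
  show "\<psi> = ?\<phi>" if "\<psi> \<in> C2 K L \<and>
      (\<forall>i\<in>{1..n}. \<forall>j\<in>{1..n}. \<psi> (x i, x j) = (if i = n \<and> j = 1 then x k else \<zero>\<^bsub>L\<^esub>))" for \<psi>
    using that 1 by (intro C2_eqI) auto
qed

lemma nf_cocycle_x:
  assumes "k \<in> {1..n}" "i \<in> {1..n}" "j \<in> {1..n}"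
  shows "nf_cocycle K L n x k (x i, x j) = (if i = n \<and> j = 1 then x k else \<zero>\<^bsub>L\<^esub>)"
  using x_mem[OF assms(1)] x_mem[OF assms(2)] x_mem[OF assms(3)]
    coord_x[OF n_mem assms(2)] coord_x[OF one_mem assms(3)]
  by (auto simp: nf_cocycle_eq[OF assms(1)])

text \<open>The bound \<open>2 \<le> k\<close> enters because the values are multiples of
  \<open>x k\<close>, which must have no first coordinate.\<close>

lemma nf_cocycle_mem_ZL2:
  assumes k: "k \<in> {2..n}"
  shows "nf_cocycle K L n x k \<in> ZL2 K L br"
proof -
  have k': "k \<in> {1..n}" using k by auto
  show ?thesis
    unfolding nf_cocycle_eq[OF k']
  proof (rule right_functional_mem_ZL2[OF coord_module_hom[OF x_mem[OF k'] n_mem]])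
    fix v assume "v \<in> carrier L"
    then show "coord (coord v n \<odot>\<^bsub>L\<^esub> x k) 1 = \<zero>\<^bsub>K\<^esub>"
      using k one_mem n_mem x_mem[OF k'] coord_x[OF one_mem k']
      by (simp add: coord_smult coord_mem)
  qed
qed

lemma comb_nf_cocycle_x:
  assumes c: "c \<in> {2..n} \<rightarrow> carrier K" and i: "i \<in> {1..n}" and j: "j \<in> {1..n}"
  shows "(\<Oplus>\<^bsub>ZL2_module K L br\<^esub>k\<in>{2..n}. c k \<odot>\<^bsub>ZL2_module K L br\<^esub> nf_cocycle K L n x k) (x i, x j)
    = (if i = n \<and> j = 1 then \<Oplus>\<^bsub>L\<^esub>k\<in>{2..n}. c k \<odot>\<^bsub>L\<^esub> x k else \<zero>\<^bsub>L\<^esub>)"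
proof -
  have "(\<Oplus>\<^bsub>ZL2_module K L br\<^esub>k\<in>{2..n}. c k \<odot>\<^bsub>ZL2_module K L br\<^esub> nf_cocycle K L n x k) (x i, x j)
      = (\<Oplus>\<^bsub>L\<^esub>k\<in>{2..n}. c k \<odot>\<^bsub>L\<^esub> nf_cocycle K L n x k (x i, x j))"
    using c nf_cocycle_mem_ZL2 x_mem[OF i] x_mem[OF j]
    by (intro ZL2_finsum_apply[OF bracket_bilinear]) auto
  also have "\<dots> = (\<Oplus>\<^bsub>L\<^esub>k\<in>{2..n}. if i = n \<and> j = 1 then c k \<odot>\<^bsub>L\<^esub> x k else \<zero>\<^bsub>L\<^esub>)"
    using c x_mem by (intro M.finsum_cong') (auto simp: nf_cocycle_x[OF _ i j] Pi_iff)
  also have "\<dots> = (if i = n \<and> j = 1 then \<Oplus>\<^bsub>L\<^esub>k\<in>{2..n}. c k \<odot>\<^bsub>L\<^esub> x k else \<zero>\<^bsub>L\<^esub>)"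
    by (cases "i = n \<and> j = 1") (simp_all only: if_P if_not_P not_False_eq_True M.finsum_zero)
  finally show ?thesis .
qed

text \<open>Coordinates are indexed from 1 but the cocycles from 2; a vanishing coefficient at 1
  bridges the two ranges.\<close>

lemma comb_from_2:
  assumes c: "c \<in> {1..n} \<rightarrow> carrier K" and c1: "c 1 = \<zero>\<^bsub>K\<^esub>"
  shows "(\<Oplus>\<^bsub>L\<^esub>k\<in>{2..n}. c k \<odot>\<^bsub>L\<^esub> x k) = (\<Oplus>\<^bsub>L\<^esub>k\<in>{1..n}. c k \<odot>\<^bsub>L\<^esub> x k)"
proof -
  have I: "{1..n} = insert 1 {2..n}" using n by auto
  have "(\<lambda>k. c k \<odot>\<^bsub>L\<^esub> x k) \<in> {2..n} \<rightarrow> carrier L"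
    using c x_mem by (auto simp: Pi_iff)
  then show ?thesis
    unfolding I using c1 x_mem[OF one_mem]
    by (subst M.finsum_insert) (auto intro: M.finsum_closed)
qed

section \<open>Consequences of the cocycle identity\<close>

text \<open>The identities at \<open>(u, v, x 1)\<close> and \<open>(u, x 1, v)\<close> are added.
  The terms \<open>shift (\<phi> (u, v))\<close> and \<open>\<phi> (shift u, v)\<close> occur with
  opposite signs and drop out, leaving \<open>\<phi> (u, shift v)\<close> and two multiples of
  \<open>shift u\<close>.\<close>

lemma cocycle_shift_coord_zero:
  assumes \<phi>: "\<phi> \<in> ZL2 K L br" and u: "u \<in> carrier L" and v: "v \<in> carrier L"
    and v1: "coord v 1 = \<zero>\<^bsub>K\<^esub>"
  shows "\<phi> (u, shift v) = \<ominus>\<^bsub>L\<^esub> ((coord (\<phi> (v, x 1)) 1 \<oplus>\<^bsub>K\<^esub> coord (\<phi> (x 1, v)) 1) \<odot>\<^bsub>L\<^esub> shift u)"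
proof -
  have C: "\<phi> \<in> C2 K L" using \<phi> by (simp add: ZL2_def)
  note b = mem_C2D(1)[OF C] and m = mem_C2D(3)[OF C]
  note sm = shift_mem and X = x_mem[OF one_mem] and x11 = coord_x[OF one_mem one_mem, simplified]
  note e = coord_mem[OF _ one_mem]
  have \<phi>0: "\<phi> (w, \<zero>\<^bsub>L\<^esub>) = \<zero>\<^bsub>L\<^esub>" "\<phi> (\<zero>\<^bsub>L\<^esub>, w) = \<zero>\<^bsub>L\<^esub>" if "w \<in> carrier L" for w
    using bilinear_map_zero[OF b that] .
  define P where "P = coord (\<phi> (v, x 1)) 1 \<odot>\<^bsub>L\<^esub> shift u"
  define Q where "Q = coord (\<phi> (x 1, v)) 1 \<odot>\<^bsub>L\<^esub> shift u"
  have mem: "P \<in> carrier L" "Q \<in> carrier L" "shift (\<phi> (u, v)) \<in> carrier L"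
    "\<phi> (u, shift v) \<in> carrier L" "\<phi> (shift u, v) \<in> carrier L"
    using u v X m sm e by (simp_all add: P_def Q_def)
  have z: "br u (\<phi> (y, z)) \<ominus>\<^bsub>L\<^esub> br (\<phi> (u, y)) z \<oplus>\<^bsub>L\<^esub> br (\<phi> (u, z)) y
         \<oplus>\<^bsub>L\<^esub> \<phi> (u, br y z) \<ominus>\<^bsub>L\<^esub> \<phi> (br u y, z) \<oplus>\<^bsub>L\<^esub> \<phi> (br u z, y) = \<zero>\<^bsub>L\<^esub>"
    if "y \<in> carrier L" "z \<in> carrier L" for y z
    using \<phi> u that by (simp add: ZL2_def)
  have "P \<ominus>\<^bsub>L\<^esub> shift (\<phi> (u, v)) \<oplus>\<^bsub>L\<^esub> \<zero>\<^bsub>L\<^esub> \<oplus>\<^bsub>L\<^esub> \<phi> (u, shift v) \<ominus>\<^bsub>L\<^esub> \<zero>\<^bsub>L\<^esub> \<oplus>\<^bsub>L\<^esub> \<phi> (shift u, v) = \<zero>\<^bsub>L\<^esub>"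
    using z[OF v X] u v X sm m by (simp add: br_eq x11 v1 P_def \<phi>0)
  moreover have "Q \<ominus>\<^bsub>L\<^esub> \<zero>\<^bsub>L\<^esub> \<oplus>\<^bsub>L\<^esub> shift (\<phi> (u, v)) \<oplus>\<^bsub>L\<^esub> \<zero>\<^bsub>L\<^esub> \<ominus>\<^bsub>L\<^esub> \<phi> (shift u, v) \<oplus>\<^bsub>L\<^esub> \<zero>\<^bsub>L\<^esub> = \<zero>\<^bsub>L\<^esub>"
    using z[OF X v] u v X sm m by (simp add: br_eq x11 v1 Q_def \<phi>0)
  ultimately have "(P \<ominus>\<^bsub>L\<^esub> shift (\<phi> (u, v)) \<oplus>\<^bsub>L\<^esub> \<zero>\<^bsub>L\<^esub> \<oplus>\<^bsub>L\<^esub> \<phi> (u, shift v) \<ominus>\<^bsub>L\<^esub> \<zero>\<^bsub>L\<^esub> \<oplus>\<^bsub>L\<^esub> \<phi> (shift u, v))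
      \<oplus>\<^bsub>L\<^esub> (Q \<ominus>\<^bsub>L\<^esub> \<zero>\<^bsub>L\<^esub> \<oplus>\<^bsub>L\<^esub> shift (\<phi> (u, v)) \<oplus>\<^bsub>L\<^esub> \<zero>\<^bsub>L\<^esub> \<ominus>\<^bsub>L\<^esub> \<phi> (shift u, v) \<oplus>\<^bsub>L\<^esub> \<zero>\<^bsub>L\<^esub>) = \<zero>\<^bsub>L\<^esub>"
    by simp
  also have "(P \<ominus>\<^bsub>L\<^esub> shift (\<phi> (u, v)) \<oplus>\<^bsub>L\<^esub> \<zero>\<^bsub>L\<^esub> \<oplus>\<^bsub>L\<^esub> \<phi> (u, shift v) \<ominus>\<^bsub>L\<^esub> \<zero>\<^bsub>L\<^esub> \<oplus>\<^bsub>L\<^esub> \<phi> (shift u, v))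
      \<oplus>\<^bsub>L\<^esub> (Q \<ominus>\<^bsub>L\<^esub> \<zero>\<^bsub>L\<^esub> \<oplus>\<^bsub>L\<^esub> shift (\<phi> (u, v)) \<oplus>\<^bsub>L\<^esub> \<zero>\<^bsub>L\<^esub> \<ominus>\<^bsub>L\<^esub> \<phi> (shift u, v) \<oplus>\<^bsub>L\<^esub> \<zero>\<^bsub>L\<^esub>)
      = \<phi> (u, shift v) \<oplus>\<^bsub>L\<^esub> (P \<oplus>\<^bsub>L\<^esub> Q)"
    using mem by algebra
  finally have "\<phi> (u, shift v) \<oplus>\<^bsub>L\<^esub> (P \<oplus>\<^bsub>L\<^esub> Q) = \<zero>\<^bsub>L\<^esub>" .
  moreover have "P \<oplus>\<^bsub>L\<^esub> Q = (coord (\<phi> (v, x 1)) 1 \<oplus>\<^bsub>K\<^esub> coord (\<phi> (x 1, v)) 1) \<odot>\<^bsub>L\<^esub> shift u"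
    using u v X m sm e by (simp add: P_def Q_def smult_l_distr)
  ultimately show ?thesis
    using mem by (metis M.minus_equality M.add.m_closed)
qed

text \<open>The vector \<open>x 1\<close> has first coordinate one, so it is treated separately. At
  \<open>(u, x 1, x 1)\<close> the second and third terms cancel, as do the last two.\<close>

lemma cocycle_shift_x1:
  assumes \<phi>: "\<phi> \<in> ZL2 K L br" and u: "u \<in> carrier L"
  shows "\<phi> (u, shift (x 1)) = \<ominus>\<^bsub>L\<^esub> (coord (\<phi> (x 1, x 1)) 1 \<odot>\<^bsub>L\<^esub> shift u)"
proof -
  have C: "\<phi> \<in> C2 K L" using \<phi> by (simp add: ZL2_def)
  note m = mem_C2D(3)[OF C]
  note sm = shift_mem and X = x_mem[OF one_mem] and x11 = coord_x[OF one_mem one_mem, simplified]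
  note e = coord_mem[OF _ one_mem]
  define P where "P = coord (\<phi> (x 1, x 1)) 1 \<odot>\<^bsub>L\<^esub> shift u"
  have mem: "P \<in> carrier L" "shift (\<phi> (u, x 1)) \<in> carrier L"
    "\<phi> (u, shift (x 1)) \<in> carrier L" "\<phi> (shift u, x 1) \<in> carrier L"
    using u X m sm e by (simp_all add: P_def)
  have "P \<ominus>\<^bsub>L\<^esub> shift (\<phi> (u, x 1)) \<oplus>\<^bsub>L\<^esub> shift (\<phi> (u, x 1)) \<oplus>\<^bsub>L\<^esub> \<phi> (u, shift (x 1))
      \<ominus>\<^bsub>L\<^esub> \<phi> (shift u, x 1) \<oplus>\<^bsub>L\<^esub> \<phi> (shift u, x 1) = \<zero>\<^bsub>L\<^esub>"
  proof -
    have "br u (\<phi> (x 1, x 1)) \<ominus>\<^bsub>L\<^esub> br (\<phi> (u, x 1)) (x 1) \<oplus>\<^bsub>L\<^esub> br (\<phi> (u, x 1)) (x 1)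
         \<oplus>\<^bsub>L\<^esub> \<phi> (u, br (x 1) (x 1)) \<ominus>\<^bsub>L\<^esub> \<phi> (br u (x 1), x 1) \<oplus>\<^bsub>L\<^esub> \<phi> (br u (x 1), x 1) = \<zero>\<^bsub>L\<^esub>"
      using \<phi> u X by (simp add: ZL2_def)
    then show ?thesis
      using u X sm m by (simp add: br_eq x11 P_def)
  qed
  also have "P \<ominus>\<^bsub>L\<^esub> shift (\<phi> (u, x 1)) \<oplus>\<^bsub>L\<^esub> shift (\<phi> (u, x 1)) \<oplus>\<^bsub>L\<^esub> \<phi> (u, shift (x 1))
      \<ominus>\<^bsub>L\<^esub> \<phi> (shift u, x 1) \<oplus>\<^bsub>L\<^esub> \<phi> (shift u, x 1) = \<phi> (u, shift (x 1)) \<oplus>\<^bsub>L\<^esub> P"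
    using mem by algebra
  finally show ?thesis
    using mem unfolding P_def by (metis M.minus_equality)
qed

text \<open>Compared with \<open>cocycle_shift_coord_zero\<close>, the coefficient lacks the
  coordinate of \<open>\<phi> (x 1, x i)\<close>. Induction on \<open>i\<close> shows that this
  coordinate vanishes for \<open>i\<close> above 1. The case \<open>i = n\<close>, where the shifted
  vector is zero, is included on purpose.\<close>

lemma cocycle_shift:
  assumes \<phi>: "\<phi> \<in> ZL2 K L br" and "i \<in> {1..n}" and u: "u \<in> carrier L"
  shows "\<phi> (u, shift (x i)) = \<ominus>\<^bsub>L\<^esub> (coord (\<phi> (x i, x 1)) 1 \<odot>\<^bsub>L\<^esub> shift u)"
  using assms(2) u
proof (induction i arbitrary: u)
  case 0
  then show ?case by simp
next
  case (Suc i)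
  have C: "\<phi> \<in> C2 K L" using \<phi> by (simp add: ZL2_def)
  note m = mem_C2D(3)[OF C] and X = x_mem[OF one_mem]
  show ?case
  proof (cases "i = 0")
    case True
    then show ?thesis using cocycle_shift_x1[OF \<phi> Suc.prems(2)] by (simp add: One_nat_def)
  next
    case False
    then have i: "i \<in> {1..n}" "i < n" using Suc.prems by auto
    then have s: "x (Suc i) = shift (x i)" using shift_x[OF i(1)] by (simp add: Suc_eq_plus1)
    \<comment> \<open>The induction hypothesis is used with first argument \<open>x 1\<close>, not
      with the current \<open>u\<close>, which is why \<open>u\<close> is generalised. It makes the
      value a multiple of a shifted vector, hence without first coordinate.\<close>
    have "\<phi> (x 1, x (Suc i)) = \<ominus>\<^bsub>L\<^esub> (coord (\<phi> (x i, x 1)) 1 \<odot>\<^bsub>L\<^esub> shift (x 1))"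
      unfolding s by (rule Suc.IH[OF i(1) X])
    then have "coord (\<phi> (x 1, x (Suc i))) 1 = \<zero>\<^bsub>K\<^esub>"
      using X x_mem[OF i(1)] m shift_mem one_mem
      by (simp add: coord_uminus coord_smult coord_shift_one coord_mem R.a_inv_zero)
    moreover have "coord (x (Suc i)) 1 = \<zero>\<^bsub>K\<^esub>"
      using s coord_shift_one[OF x_mem[OF i(1)]] by simp
    ultimately show ?thesis
      using cocycle_shift_coord_zero[OF \<phi> Suc.prems(2) x_mem[OF Suc.prems(1)]] m X x_mem[OF Suc.prems(1)]
        one_mem
      by (simp add: coord_mem)
  qed
qed

text \<open>At \<open>i = n\<close> the left side of \<open>cocycle_shift\<close> is zero. With
  \<open>u = x 1\<close> the right side is a multiple of \<open>x 2\<close>, a basis vector because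
  \<open>2 \<le> n\<close>, so the coefficient must vanish.\<close>

lemma coord_cocycle_n_one:
  assumes \<phi>: "\<phi> \<in> ZL2 K L br"
  shows "coord (\<phi> (x n, x 1)) 1 = \<zero>\<^bsub>K\<^esub>"
proof -
  have C: "\<phi> \<in> C2 K L" using \<phi> by (simp add: ZL2_def)
  note X = x_mem[OF one_mem] and Xn = x_mem[OF n_mem]
  note e = coord_mem[OF mem_C2D(3)[OF C Xn X] one_mem]
  have two: "2 \<in> {1..n}" using n by auto
  have "\<phi> (x 1, \<zero>\<^bsub>L\<^esub>) = \<zero>\<^bsub>L\<^esub>"
    using bilinear_map_zero(1)[OF mem_C2D(1)[OF C] X] .
  moreover have "shift (x n) = \<zero>\<^bsub>L\<^esub>" "shift (x 1) = x 2"
    using shift_x[OF n_mem] shift_x[OF one_mem] n by simp_all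
  ultimately have "\<ominus>\<^bsub>L\<^esub> (coord (\<phi> (x n, x 1)) 1 \<odot>\<^bsub>L\<^esub> x 2) = \<zero>\<^bsub>L\<^esub>"
    using cocycle_shift[OF \<phi> n_mem X] by simp
  then have "coord (\<phi> (x n, x 1)) 1 \<odot>\<^bsub>L\<^esub> x 2 = \<zero>\<^bsub>K\<^esub> \<odot>\<^bsub>L\<^esub> x 2"
    using e x_mem[OF two] by (metis M.minus_minus M.add.inv_one a_inv_def lmult_0 smult_closed)
  then show ?thesis
    using smult_x_cancel[OF e _ two] by simp
qed

section \<open>Spanning and independence modulo coboundaries\<close>

lemma cocycle_decomposition:
  assumes \<phi>: "\<phi> \<in> ZL2 K L br"
  shows "\<exists>c\<in>{2..n} \<rightarrow> carrier K.
    \<phi> \<ominus>\<^bsub>ZL2_module K L br\<^esub>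
      (\<Oplus>\<^bsub>ZL2_module K L br\<^esub>k\<in>{2..n}. c k \<odot>\<^bsub>ZL2_module K L br\<^esub> nf_cocycle K L n x k) \<in> BL2 K L br"
proof -
  interpret Z: module K "ZL2_module K L br" by (rule module_ZL2_module[OF bracket_bilinear])
  have C: "\<phi> \<in> C2 K L" using \<phi> by (simp add: ZL2_def)
  note m = mem_C2D(3)[OF C] and sm = shift_mem
  note X = x_mem[OF one_mem] and Xn = x_mem[OF n_mem]
  \<comment> \<open>These are the values of \<open>f\<close> on the basis. The entry
    \<open>y 0\<close> is a filler, and the branch at 0 starts the sequence with
    \<open>y 1 = 0\<close>. The recursion solves
    \<open>d1 L br f (x i, x 1) = \<phi> (x i, x 1)\<close> for
    \<open>f (x (i + 1))\<close>.\<close>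
  define y where "y = rec_nat \<zero>\<^bsub>L\<^esub>
    (\<lambda>i v. if i = 0 then \<zero>\<^bsub>L\<^esub> else shift v \<ominus>\<^bsub>L\<^esub> \<phi> (x i, x 1))"
  have y1: "y 1 = \<zero>\<^bsub>L\<^esub>" by (simp add: y_def One_nat_def)
  have y_step: "y (i + 1) = shift (y i) \<ominus>\<^bsub>L\<^esub> \<phi> (x i, x 1)" if "i \<noteq> 0" for i
    using that by (simp add: y_def flip: Suc_eq_plus1)
  have y_mem: "i \<le> n \<Longrightarrow> y i \<in> carrier L" for i
  proof (induction i)
    case 0
    then show ?case by (simp add: y_def)
  next
    case (Suc i)
    then show ?case using y_step[of i] y1 sm m X x_mem[of i] by (cases "i = 0") (auto simp: One_nat_def)
  qed
  obtain f where f: "f \<in> module_hom K L L" and fx: "\<And>i. i \<in> {1..n} \<Longrightarrow> f (x i) = y i"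
    using ex_module_hom[of y] y_mem by auto
  note fm = module_hom_mem[OF f]
  \<comment> \<open>At the pair \<open>(x n, x 1)\<close> no further basis value of \<open>f\<close>
    is free, since \<open>shift (x n)\<close> is zero. The vector \<open>h\<close> is the remaining
    discrepancy, and its coordinates become the coefficients of the cocycles.\<close>
  define h where "h = \<phi> (x n, x 1) \<ominus>\<^bsub>L\<^esub> shift (f (x n))"
  define c where "c = coord h"
  have h: "h \<in> carrier L" using m sm fm X Xn by (simp add: h_def)
  have c: "c \<in> {1..n} \<rightarrow> carrier K" using coord_mem[OF h] by (simp add: c_def)
  then have c': "c \<in> {2..n} \<rightarrow> carrier K" by auto
  \<comment> \<open>By \<open>coord_cocycle_n_one\<close> the discrepancy has no first coordinate,
    so the indices from 2 on suffice.\<close>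
  have "c 1 = \<zero>\<^bsub>K\<^esub>"
    using m sm fm X Xn one_mem
    by (simp add: c_def h_def coord_minus coord_cocycle_n_one[OF \<phi>] coord_shift_one)
  then have sum_h: "(\<Oplus>\<^bsub>L\<^esub>k\<in>{2..n}. c k \<odot>\<^bsub>L\<^esub> x k) = h"
    using comb_from_2[OF c] coord_sum[OF h] by (simp add: c_def)
  let ?s = "\<Oplus>\<^bsub>ZL2_module K L br\<^esub>k\<in>{2..n}. c k \<odot>\<^bsub>ZL2_module K L br\<^esub> nf_cocycle K L n x k"
  have dZ: "d1 L br f \<in> carrier (ZL2_module K L br)" and \<phi>Z: "\<phi> \<in> carrier (ZL2_module K L br)"
    using d1_mem_ZL2[OF f] \<phi> by (simp_all add: ZL2_module_simps)
  have sZ: "?s \<in> carrier (ZL2_module K L br)"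
    using c' nf_cocycle_mem_ZL2
    by (intro Z.M.finsum_closed Pi_I Z.smult_closed) (auto simp: ZL2_module_simps(1))
  have f1: "coord (f (x 1)) 1 = \<zero>\<^bsub>K\<^esub>" "f (x 1) = \<zero>\<^bsub>L\<^esub>"
    using fx[OF one_mem] y1 coord_zero[OF one_mem] by simp_all
  have f0: "f \<zero>\<^bsub>L\<^esub> = \<zero>\<^bsub>L\<^esub>"
    using f by (rule module_hom_at_zero)
  have "\<phi> = d1 L br f \<oplus>\<^bsub>ZL2_module K L br\<^esub> ?s"
  proof (rule C2_eqI[OF C])
    show "d1 L br f \<oplus>\<^bsub>ZL2_module K L br\<^esub> ?s \<in> C2 K L"
      using Z.M.add.m_closed[OF dZ sZ] by (simp add: ZL2_module_simps(1)) (simp add: ZL2_def)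
    fix i j assume i: "i \<in> {1..n}" and j: "j \<in> {1..n}"
    note Xi = x_mem[OF i] and Xj = x_mem[OF j]
    have "(d1 L br f \<oplus>\<^bsub>ZL2_module K L br\<^esub> ?s) (x i, x j) = d1 L br f (x i, x j) \<oplus>\<^bsub>L\<^esub> ?s (x i, x j)"
      using Xi Xj by (simp add: ZL2_module_simps(3))
    also have "\<dots> = d1 L br f (x i, x j) \<oplus>\<^bsub>L\<^esub> (if i = n \<and> j = 1 then h else \<zero>\<^bsub>L\<^esub>)"
      using comb_nf_cocycle_x[OF c' i j] sum_h by simp
    also have "\<dots> = \<phi> (x i, x j)"
    proof (cases "j = 1")
      case True
      have d: "d1 L br f (x i, x 1) = shift (f (x i)) \<ominus>\<^bsub>L\<^esub> f (shift (x i))"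
        using Xi X sm fm coord_x[OF one_mem one_mem] by (simp add: d1_eq[OF f] f1(1))
      show ?thesis
      proof (cases "i = n")
        case True
        have "shift (x n) = \<zero>\<^bsub>L\<^esub>" using shift_x[OF n_mem] by simp
        then have "d1 L br f (x n, x 1) = shift (f (x n))"
          using d True Xn sm fm f0 by (simp add: a_minus_def M.a_inv_zero)
        moreover have "shift (f (x n)) \<oplus>\<^bsub>L\<^esub> h = \<phi> (x n, x 1)"
        proof -
          have "shift (f (x n)) \<in> carrier L" "\<phi> (x n, x 1) \<in> carrier L" using Xn X sm fm m by auto
          then show ?thesis unfolding h_def by algebra
        qed
        ultimately show ?thesis using True \<open>j = 1\<close> by simp
      next
        case False
        then have "i + 1 \<in> {1..n}" "i \<noteq> 0" "shift (x i) = x (i + 1)"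
          using i shift_x[OF i] by auto
        then have "d1 L br f (x i, x 1) = shift (f (x i)) \<ominus>\<^bsub>L\<^esub> (shift (f (x i)) \<ominus>\<^bsub>L\<^esub> \<phi> (x i, x 1))"
          using d fx[of "i + 1"] fx[OF i] y_step[of i] by simp
        also have "\<dots> = \<phi> (x i, x 1)"
        proof -
          have "shift (f (x i)) \<in> carrier L" "\<phi> (x i, x 1) \<in> carrier L" using Xi X sm fm m by auto
          then show ?thesis by algebra
        qed
        finally show ?thesis using False \<open>j = 1\<close> m[OF Xi X] by simp
      qed
    next
      case False
      then have j': "j - 1 \<in> {1..n}" "j - 1 \<noteq> 0" "j - 1 + 1 = j" "j - 1 < n" using j by auto
      then have sj: "shift (x (j - 1)) = x j" using shift_x[OF j'(1)] by simp
      \<comment> \<open>For \<open>j\<close> other than 1 no freedom is left, but the recursion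
        gives \<open>f (x j)\<close> exactly the first coordinate that \<open>cocycle_shift\<close>
        at \<open>j - 1\<close> requires, so both sides are the same multiple of
        \<open>shift (x i)\<close>.\<close>
      have "f (x j) = shift (f (x (j - 1))) \<ominus>\<^bsub>L\<^esub> \<phi> (x (j - 1), x 1)"
        using y_step[OF j'(2)] fx[OF j] fx[OF j'(1)] j'(3) by simp
      then have "coord (f (x j)) 1 = \<ominus>\<^bsub>K\<^esub> coord (\<phi> (x (j - 1), x 1)) 1"
        using m[OF x_mem[OF j'(1)] X] sm fm[OF x_mem[OF j'(1)]] one_mem
        by (simp add: coord_add coord_uminus coord_shift_one coord_mem a_minus_def)
      moreover have "\<phi> (x i, x j) = \<ominus>\<^bsub>L\<^esub> (coord (\<phi> (x (j - 1), x 1)) 1 \<odot>\<^bsub>L\<^esub> shift (x i))"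
        using cocycle_shift[OF \<phi> j'(1) Xi] sj by simp
      moreover have "coord (x j) 1 = \<zero>\<^bsub>K\<^esub>" using coord_x[OF one_mem j] False by simp
      ultimately show ?thesis
        using False Xi Xj sm fm m[OF x_mem[OF j'(1)] X] one_mem
        by (simp add: d1_eq[OF f] smult_l_minus coord_mem a_minus_def M.a_inv_zero)
    qed
    finally show "\<phi> (x i, x j) = (d1 L br f \<oplus>\<^bsub>ZL2_module K L br\<^esub> ?s) (x i, x j)" ..
  qed
  then have "\<phi> \<ominus>\<^bsub>ZL2_module K L br\<^esub> ?s = (d1 L br f \<oplus>\<^bsub>ZL2_module K L br\<^esub> ?s) \<ominus>\<^bsub>ZL2_module K L br\<^esub> ?s"
    by simp
  also have "\<dots> = d1 L br f"
    using dZ sZ by (simp add: Z.M.minus_eq Z.M.a_assoc Z.M.r_neg)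
  also have "\<dots> \<in> BL2 K L br" using f by (simp add: BL2_def)
  finally show ?thesis using c' by blast
qed

lemma nf_cocycle_independent:
  assumes c: "c \<in> {2..n} \<rightarrow> carrier K" and k: "k \<in> {2..n}"
    and B: "(\<Oplus>\<^bsub>ZL2_module K L br\<^esub>k\<in>{2..n}. c k \<odot>\<^bsub>ZL2_module K L br\<^esub> nf_cocycle K L n x k) \<in> BL2 K L br"
  shows "c k = \<zero>\<^bsub>K\<^esub>"
proof -
  obtain f where f: "f \<in> module_hom K L L" and
    eq: "(\<Oplus>\<^bsub>ZL2_module K L br\<^esub>k\<in>{2..n}. c k \<odot>\<^bsub>ZL2_module K L br\<^esub> nf_cocycle K L n x k) = d1 L br f"
    using B by (auto simp: BL2_def)
  note fm = module_hom_mem[OF f] and sm = shift_mem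
  note X = x_mem[OF one_mem] and Xn = x_mem[OF n_mem]
  define a where "a = coord (f (x 1)) 1"
  have a: "a \<in> carrier K" using coord_mem[OF fm[OF X] one_mem] by (simp add: a_def)
  have d: "d1 L br f (x i, x 1) = a \<odot>\<^bsub>L\<^esub> shift (x i) \<oplus>\<^bsub>L\<^esub> shift (f (x i)) \<ominus>\<^bsub>L\<^esub> f (shift (x i))"
    if "i \<in> {1..n}" for i
    using x_mem[OF that] X sm fm coord_x[OF one_mem one_mem]
    by (simp add: d1_eq[OF f] a_def)
  \<comment> \<open>Below \<open>n\<close> the combination vanishes at \<open>(x i, x 1)\<close>,
    and solving \<open>d1 L br f (x i, x 1) = 0\<close> gives the recursion.\<close>
  have step: "f (x (i + 1)) = a \<odot>\<^bsub>L\<^esub> x (i + 1) \<oplus>\<^bsub>L\<^esub> shift (f (x i))" if "i \<in> {1..n}" "i < n" for i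
  proof -
    have i1: "i + 1 \<in> {1..n}" using that by auto
    have "a \<odot>\<^bsub>L\<^esub> x (i + 1) \<oplus>\<^bsub>L\<^esub> shift (f (x i)) \<ominus>\<^bsub>L\<^esub> f (x (i + 1)) = \<zero>\<^bsub>L\<^esub>"
      using d[OF that(1)] comb_nf_cocycle_x[OF c that(1) one_mem] that
        shift_x[OF that(1)] eq by simp
    then show ?thesis
      using a x_mem[OF i1] fm[OF x_mem[OF i1]] sm[OF fm[OF x_mem[OF that(1)]]] by simp
  qed
  \<comment> \<open>The recursion makes \<open>f\<close> triangular: the shift raises indices by
    one, and the added multiple of \<open>x (i + 1)\<close> sits at the lowest admissible
    place.\<close>
  have low: "i \<in> {1..n} \<Longrightarrow> j \<in> {1..n} \<Longrightarrow> j < i \<Longrightarrow> coord (f (x i)) j = \<zero>\<^bsub>K\<^esub>" for i j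
  proof (induction i arbitrary: j)
    case (Suc i)
    then have i: "i \<in> {1..n}" "i < n" and i1: "Suc i \<in> {1..n}" by auto
    have "coord (shift (f (x i))) j = \<zero>\<^bsub>K\<^esub>"
    proof (cases "j = 1")
      case False
      then have "j - 1 \<in> {1..n}" "j - 1 < i" using Suc.prems by auto
      then show ?thesis
        using Suc.IH[OF i(1)] False coord_shift[OF fm[OF x_mem[OF i(1)]] Suc.prems(2)] by simp
    qed (use coord_shift_one[OF fm[OF x_mem[OF i(1)]]] in simp)
    moreover have "coord (x (Suc i)) j = \<zero>\<^bsub>K\<^esub>"
      using coord_x[OF Suc.prems(2) i1] Suc.prems(3) by simp
    ultimately show ?case
      using step[OF i] a x_mem[OF i1] sm[OF fm[OF x_mem[OF i(1)]]] Suc.prems(2)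
      by (simp add: coord_add coord_smult Suc_eq_plus1)
  qed simp
  have f0: "f \<zero>\<^bsub>L\<^esub> = \<zero>\<^bsub>L\<^esub>"
    using f by (rule module_hom_at_zero)
  have "shift (x n) = \<zero>\<^bsub>L\<^esub>" using shift_x[OF n_mem] by simp
  then have sum: "(\<Oplus>\<^bsub>L\<^esub>k\<in>{2..n}. c k \<odot>\<^bsub>L\<^esub> x k) = shift (f (x n))"
    using d[OF n_mem] comb_nf_cocycle_x[OF c n_mem one_mem] eq f0 a sm[OF fm[OF Xn]]
    by (simp add: a_minus_def M.a_inv_zero)
  \<comment> \<open>The coefficients are given only from index 2 on. They are set to zero at 1 so
    that \<open>coord_comb\<close>, which uses the full basis, can read them off.\<close>
  let ?c = "c(1 := \<zero>\<^bsub>K\<^esub>)"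
  have c1: "?c \<in> {1..n} \<rightarrow> carrier K" using c by (auto simp: Pi_iff)
  have "(\<Oplus>\<^bsub>L\<^esub>k\<in>{2..n}. c k \<odot>\<^bsub>L\<^esub> x k) = (\<Oplus>\<^bsub>L\<^esub>k\<in>{2..n}. ?c k \<odot>\<^bsub>L\<^esub> x k)"
    using c x_mem by (intro M.finsum_cong') (auto simp: Pi_iff)
  also have "\<dots> = (\<Oplus>\<^bsub>L\<^esub>k\<in>{1..n}. ?c k \<odot>\<^bsub>L\<^esub> x k)"
    using comb_from_2[OF c1] by simp
  finally have sum': "(\<Oplus>\<^bsub>L\<^esub>k\<in>{1..n}. ?c k \<odot>\<^bsub>L\<^esub> x k) = shift (f (x n))" using sum by simp
  have k1: "k \<in> {1..n}" "k - 1 \<in> {1..n}" "k - 1 < n" "k \<noteq> 1" using k by auto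
  have "c k = coord (shift (f (x n))) k"
    using coord_comb[OF c1 k1(1)] k1(4) unfolding sum' by simp
  \<comment> \<open>The shift lowers the coordinate index to \<open>k - 1\<close>, which is below
    \<open>n\<close>, so triangularity at \<open>x n\<close> makes it vanish.\<close>
  also have "\<dots> = coord (f (x n)) (k - 1)"
    using coord_shift[OF fm[OF Xn] k1(1)] k1(4) by simp
  also have "\<dots> = \<zero>\<^bsub>K\<^esub>" by (rule low[OF n_mem k1(2,3)])
  finally show ?thesis .
qed

end

end

theorem corollary3p4:
  fixes K :: "('k, 'r) ring_scheme" and L :: "('k, 'v, 'm) module_scheme"
    and br :: "'v \<Rightarrow> 'v \<Rightarrow> 'v" and n :: nat and x :: "nat \<Rightarrow> 'v"
  assumes "char_zero K"
    and "null_filiform K L br n x"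
    and "n \<ge> 2"
  shows "vectorspace K (HL2 K L br)
    \<and> (\<forall>k\<in>{2..n}. nf_cocycle K L n x k \<in> ZL2 K L br)
    \<and> inj_on (\<lambda>k. coh_class K L br (nf_cocycle K L n x k)) {2..n}
    \<and> vectorspace.basis K (HL2 K L br)
        ((\<lambda>k. coh_class K L br (nf_cocycle K L n x k)) ` {2..n})
    \<and> vectorspace.fin_dim K (HL2 K L br)
    \<and> vectorspace.dim K (HL2 K L br) = n - 1"
proof -
  interpret null_filiform K L br n x by fact
  note n = assms(3)
  let ?cls = "\<lambda>k. coh_class K L br (nf_cocycle K L n x k)"
  have V: "vectorspace K (HL2 K L br)"
    unfolding HL2_def by (rule vectorspace_quot_module[OF subspace_BL2[OF n]])
  interpret H: vectorspace K "HL2 K L br" by (rule V)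
  \<comment> \<open>The two conditions of \<open>basis_quot_module\<close> are supplied by
    \<open>cocycle_decomposition\<close> and \<open>nf_cocycle_independent\<close>.\<close>
  have "inj_on ?cls {2..n} \<and> vectorspace.basis K (HL2 K L br) (?cls ` {2..n})"
    unfolding HL2_def coh_class_def
    by (intro basis_quot_module[OF subspace_BL2[OF n]])
      (auto simp: ZL2_module_simps(1) nf_cocycle_mem_ZL2[OF n]
        intro: cocycle_decomposition[OF n] nf_cocycle_independent[OF n])
  then have inj: "inj_on ?cls {2..n}" and basis: "H.basis (?cls ` {2..n})" by auto
  \<comment> \<open>The dimension is the cardinality of the set of classes; by injectivity this is
    the size of the index range from 2 to \<open>n\<close>.\<close>
  have "H.dim = n - 1"
    using H.dim_basis[OF _ basis] card_image[OF inj] by simp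
  moreover have "H.fin_dim"
    using basis unfolding H.fin_dim_def H.basis_def by blast
  ultimately show ?thesis
    using V inj basis nf_cocycle_mem_ZL2[OF n] by blast
qed

end
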